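(* Let $n,k,t$ be integers with $k\geq t\geq 1$ and $n\geq \frac{3k^2+k+2}{2}$. Then the scramble number and the gonality of the generalized Kneser graph $KG(n,k,t)$ satisfy $$\operatorname{sn}(KG(n,k,t)) = \operatorname{gon}(KG(n,k,t)) = \binom{n}{k}-\binom{n-t}{k-t}.$$
   Context: Generalized Kneser graph: for integers $n\ge k\ge t\ge 1$, $KG(n,k,t)$ is the simple graph whose vertices are the $k$-element subsets of $[n]=\{1,\dots,n\}$, with two distinct vertices $A,B$ adjacent if and only if $|A\cap B|<t$. Gonality: let $G$ be a finite connected simple graph. A divisor on $G$ is a function $D:V(G)\to\mathbb{Z}$; its degree is $\deg(D)=\sum_{v}D(v)$; it is effective if $D(v)\ge 0$ for all $v$. Firing a vertex $v$ replaces $D$ by the divisor obtained by decreasing $D(v)$ by the number of neighbours of $v$ and increasing $D(w)$ by $1$ for each neighbour $w$ of $v$. Two divisors are equivalent if one is obtained from the other by a finite sequence of firings. The rank $\operatorname{rk}(D)$ is $-1$ if $D$ is not equivalent to an effective divisor, and otherwise is the largest integer $r\ge 0$ such that $D-E$ is equivalent to an effective divisor for every effective divisor $E$ of degree $r$. The gonality is $\operatorname{gon}(G)=\min\{\deg(D):\operatorname{rk}(D)\ge 1\}$. Scramble number: an egg is a nonempty set of vertices of $G$ inducing a connected subgraph; a scramble $\mathcal{S}$ is a finite set of eggs. A hitting set of $\mathcal{S}$ is a set of vertices meeting every egg; $h(\mathcal{S})$ is the minimum size of a hitting set. An egg-cut of $\mathcal{S}$ is a set $C$ of edges such that at least two distinct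 connected components of the graph obtained by deleting $C$ each contain an egg; $e(\mathcal{S})$ is the minimum size of an egg-cut, with $e(\mathcal{S})=\infty$ if there is none. The order of $\mathcal{S}$ is $\min\{h(\mathcal{S}),e(\mathcal{S})\}$, and $\operatorname{sn}(G)$ is the maximum order of a scramble on $G$. *)

theory Defs
  imports Complex_Main "HOL-Library.Extended_Nat"
begin

text \<open>An edge is the two-element set of its end points. The record does not enforce this, nor
  finiteness; the definitions below are meant for finite simple graphs.\<close>

record 'a sgraph =
  vertices :: "'a set"
  edges :: "'a set set"

definition adjacent :: "'a sgraph \<Rightarrow> 'a \<Rightarrow> 'a \<Rightarrow> bool" where
  "adjacent G u v \<longleftrightarrow> {u, v} \<in> edges G"

definition neighbours :: "'a sgraph \<Rightarrow> 'a \<Rightarrow> 'a set" where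
  "neighbours G v = {w \<in> vertices G. adjacent G v w}"

definition components :: "'a sgraph \<Rightarrow> 'a set set" where
  "components G = {{v \<in> vertices G. (adjacent G)\<^sup>*\<^sup>* u v} | u. u \<in> vertices G}"

definition connected_sgraph :: "'a sgraph \<Rightarrow> bool" where
  "connected_sgraph G \<longleftrightarrow>
     vertices G \<noteq> {} \<and> (\<forall>u \<in> vertices G. \<forall>v \<in> vertices G. (adjacent G)\<^sup>*\<^sup>* u v)"

definition induced_sgraph :: "'a sgraph \<Rightarrow> 'a set \<Rightarrow> 'a sgraph" where
  "induced_sgraph G U = \<lparr>vertices = U, edges = {e \<in> edges G. e \<subseteq> U}\<rparr>"

definition delete_edges :: "'a sgraph \<Rightarrow> 'a set set \<Rightarrow> 'a sgraph" where
  "delete_edges G C = \<lparr>vertices = vertices G, edges = edges G - C\<rparr>"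

definition kneser_graph :: "nat \<Rightarrow> nat \<Rightarrow> nat \<Rightarrow> nat set sgraph" where
  "kneser_graph n k t =
     (let V = {A. A \<subseteq> {1..n} \<and> card A = k}
      in \<lparr>vertices = V,
          edges = {{A, B} | A B. A \<in> V \<and> B \<in> V \<and> A \<noteq> B \<and> card (A \<inter> B) < t}\<rparr>)"


subsection \<open>Gonality\<close>

text \<open>A divisor is represented by its extension by zero to the whole vertex type.\<close>

definition divisor :: "'a sgraph \<Rightarrow> ('a \<Rightarrow> int) \<Rightarrow> bool" where
  "divisor G D \<longleftrightarrow> (\<forall>v. v \<notin> vertices G \<longrightarrow> D v = 0)"

definition divisor_degree :: "'a sgraph \<Rightarrow> ('a \<Rightarrow> int) \<Rightarrow> int" where
  "divisor_degree G D = (\<Sum>v \<in> vertices G. D v)"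

definition effective :: "'a sgraph \<Rightarrow> ('a \<Rightarrow> int) \<Rightarrow> bool" where
  "effective G D \<longleftrightarrow> divisor G D \<and> (\<forall>v \<in> vertices G. D v \<ge> 0)"

definition fire :: "'a sgraph \<Rightarrow> 'a \<Rightarrow> ('a \<Rightarrow> int) \<Rightarrow> ('a \<Rightarrow> int)" where
  "fire G v D =
     (\<lambda>w. if w = v then D v - int (card (neighbours G v))
          else if w \<in> neighbours G v then D w + 1
          else D w)"

definition fires_to :: "'a sgraph \<Rightarrow> ('a \<Rightarrow> int) \<Rightarrow> ('a \<Rightarrow> int) \<Rightarrow> bool" where
  "fires_to G = (\<lambda>D D'. \<exists>v \<in> vertices G. D' = fire G v D)\<^sup>*\<^sup>*"

definition equivalent_divisors :: "'a sgraph \<Rightarrow> ('a \<Rightarrow> int) \<Rightarrow> ('a \<Rightarrow> int) \<Rightarrow> bool" where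
  "equivalent_divisors G D D' \<longleftrightarrow> fires_to G D D' \<or> fires_to G D' D"

definition equivalent_to_effective :: "'a sgraph \<Rightarrow> ('a \<Rightarrow> int) \<Rightarrow> bool" where
  "equivalent_to_effective G D \<longleftrightarrow> (\<exists>D'. effective G D' \<and> equivalent_divisors G D D')"

definition divisor_rank :: "'a sgraph \<Rightarrow> ('a \<Rightarrow> int) \<Rightarrow> int" where
  "divisor_rank G D =
     (if \<not> equivalent_to_effective G D then -1
      else int (GREATEST r :: nat. \<forall>E. effective G E \<and> divisor_degree G E = int r \<longrightarrow>
                  equivalent_to_effective G (\<lambda>v. D v - E v)))"

text \<open>The minimum exists on every finite nonempty graph: a divisor of rank at least 1 has
  positive degree, and the all-ones divisor has rank at least 1.\<close>

definition gonality :: "'a sgraph \<Rightarrow> int" where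
  "gonality G =
     (LEAST d. \<exists>D. divisor G D \<and> divisor_rank G D \<ge> 1 \<and> divisor_degree G D = d)"


subsection \<open>Scramble number\<close>

definition egg :: "'a sgraph \<Rightarrow> 'a set \<Rightarrow> bool" where
  "egg G U \<longleftrightarrow> U \<noteq> {} \<and> U \<subseteq> vertices G \<and> connected_sgraph (induced_sgraph G U)"

definition scramble :: "'a sgraph \<Rightarrow> 'a set set \<Rightarrow> bool" where
  "scramble G S \<longleftrightarrow> finite S \<and> (\<forall>U \<in> S. egg G U)"

definition hitting_set :: "'a sgraph \<Rightarrow> 'a set set \<Rightarrow> 'a set \<Rightarrow> bool" where
  "hitting_set G S H \<longleftrightarrow> H \<subseteq> vertices G \<and> (\<forall>U \<in> S. H \<inter> U \<noteq> {})"

definition hitting_number :: "'a sgraph \<Rightarrow> 'a set set \<Rightarrow> nat" where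
  "hitting_number G S = (LEAST m. \<exists>H. hitting_set G S H \<and> card H = m)"

definition egg_cut :: "'a sgraph \<Rightarrow> 'a set set \<Rightarrow> 'a set set \<Rightarrow> bool" where
  "egg_cut G S C \<longleftrightarrow> C \<subseteq> edges G \<and>
     (\<exists>X \<in> components (delete_edges G C). \<exists>Y \<in> components (delete_edges G C).
        X \<noteq> Y \<and> (\<exists>U \<in> S. U \<subseteq> X) \<and> (\<exists>U \<in> S. U \<subseteq> Y))"

text \<open>The infimum over the empty set is \<open>\<infinity>\<close>.\<close>

definition egg_cut_number :: "'a sgraph \<Rightarrow> 'a set set \<Rightarrow> enat" where
  "egg_cut_number G S = (INF C \<in> {C. egg_cut G S C}. enat (card C))"

definition scramble_order :: "'a sgraph \<Rightarrow> 'a set set \<Rightarrow> enat" where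
  "scramble_order G S = min (enat (hitting_number G S)) (egg_cut_number G S)"

text \<open>Every order is finite, being at most the hitting number.\<close>

definition scramble_number :: "'a sgraph \<Rightarrow> nat" where
  "scramble_number G = (GREATEST m. \<exists>S. scramble G S \<and> scramble_order G S = enat m)"

end

theory Submission
  imports Defs
begin

text \<open>
  Write \<open>N\<close> for the number of vertices, \<open>\<alpha>\<close> for the independence number and \<open>d\<close> for the minimum
  degree. If \<open>2 d > N\<close>, then every vertex set with at least two vertices on either side has at least
  \<open>N - 1\<close> boundary edges, and this forces both invariants to be \<open>N - \<alpha>\<close>. The scramble of all edges has
  order at least \<open>N - \<alpha>\<close>; conversely, an egg inside a maximum independent set is a single vertex, which
  is cut off by its at most \<open>N - \<alpha>\<close> edges. One chip on each vertex outside a maximum independent set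
  has rank at least 1; conversely, in a divisor of rank at least 1 and smaller degree some vertex has
  at least \<open>d\<close> chips, and after firing it a second one does, which takes \<open>2 d - 1 \<ge> N\<close> chips in total.

  For the Kneser graph \<open>d \<ge> (n - k) choose k\<close>, and \<open>2 d > N\<close> is a numerical fact. The value of \<open>\<alpha>\<close> is
  the Erdos--Ko--Rado theorem for \<open>t\<close>-intersecting families; as \<open>n\<close> is quadratic in \<open>k\<close>, a shifted family
  outside the star can be bounded by a union bound over the prefixes \<open>{1..t + 2 i}\<close> that Frankl's
  lemma provides.
\<close>

subsection \<open>Scrambles and divisors on dense graphs\<close>

locale simple_sgraph =
  fixes G :: "'a sgraph"
  assumes finite_vertices: "finite (vertices G)"
    and edge_ends: "e \<in> edges G \<Longrightarrow> \<exists>u \<in> vertices G. \<exists>v \<in> vertices G. u \<noteq> v \<and> e = {u, v}"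
begin

abbreviation V where "V \<equiv> vertices G"

definition independent :: "'a set \<Rightarrow> bool" where
  "independent I \<longleftrightarrow> I \<subseteq> V \<and> (\<forall>u \<in> I. \<forall>v \<in> I. \<not> adjacent G u v)"

text \<open>The chips that \<open>v\<close> loses when every vertex \<open>u\<close> is fired
  \<open>f u\<close> times; \<open>f\<close> is a firing script, and negative values stand for
  borrowing.\<close>

definition laplacian :: "('a \<Rightarrow> int) \<Rightarrow> 'a \<Rightarrow> int" where
  "laplacian f v = (\<Sum>w \<in> neighbours G v. f v - f w)"

text \<open>Each boundary edge occurs once, oriented outwards, which makes the count a plain sum of
  outward degrees over \<open>W\<close>.\<close>

definition boundary :: "'a set \<Rightarrow> ('a \<times> 'a) set" where
  "boundary W = (SIGMA v:W. neighbours G v - W)"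

lemma adjacent_sym: "adjacent G u v \<Longrightarrow> adjacent G v u"
  by (simp add: adjacent_def insert_commute)

lemma adjacent_commute: "adjacent G u v \<longleftrightarrow> adjacent G v u"
  using adjacent_sym by blast

lemma adjacentD: "adjacent G u v \<Longrightarrow> u \<in> V \<and> v \<in> V \<and> u \<noteq> v"
  unfolding adjacent_def using edge_ends by (metis doubleton_eq_iff)

lemma mem_neighbours: "w \<in> neighbours G v \<longleftrightarrow> adjacent G v w"
  using adjacentD by (auto simp: neighbours_def)

lemma neighbours_sym: "w \<in> neighbours G v \<longleftrightarrow> v \<in> neighbours G w"
  using adjacent_sym by (auto simp: mem_neighbours)

lemma neighbours_subset: "neighbours G v \<subseteq> V - {v}"
  using adjacentD by (auto simp: mem_neighbours; metis)

lemma finite_neighbours: "finite (neighbours G v)"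
  using neighbours_subset finite_vertices by (meson finite_Diff finite_subset)

lemma finite_edges: "finite (edges G)"
  using finite_vertices by (rule finite_subset[rotated, OF finite_Pow_iff[THEN iffD2]]) (use edge_ends in blast)

section \<open>Firing scripts and the Laplacian\<close>

lemma sum_laplacian: "(\<Sum>v \<in> V. laplacian f v) = 0"
proof -
  have "(\<Sum>v \<in> V. \<Sum>w \<in> neighbours G v. f w) = (\<Sum>v \<in> V. \<Sum>w \<in> neighbours G v. f v)"
    unfolding neighbours_def
    by (subst sum.swap_restrict[OF finite_vertices finite_vertices]) (simp only: adjacent_commute)
  then show ?thesis by (simp add: laplacian_def sum_subtractf)
qed

lemma laplacian_add: "laplacian (\<lambda>u. f u + g u) v = laplacian f v + laplacian g v"
  by (simp add: laplacian_def sum.distrib sum_subtractf algebra_simps)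

lemma laplacian_uminus: "laplacian (\<lambda>u. - f u) v = - laplacian f v"
  by (simp add: laplacian_def sum_negf sum_subtractf)

lemma fire_eq_laplacian:
  "fire G v D w = D w - laplacian (\<lambda>u. if u = v then 1 else 0) w"
proof (cases "w = v")
  case True
  have "laplacian (\<lambda>u. if u = v then 1 else 0) v = (\<Sum>w \<in> neighbours G v. 1)"
    unfolding laplacian_def using neighbours_subset by (intro sum.cong) auto
  with True show ?thesis by (simp add: fire_def)
next
  case False
  then have "laplacian (\<lambda>u. if u = v then 1 else 0) w
    = (\<Sum>u \<in> neighbours G w. if u = v then - 1 else 0)"
    unfolding laplacian_def by (intro sum.cong) auto
  also have "\<dots> = (if v \<in> neighbours G w then - 1 else 0)"
    using finite_neighbours by simp
  finally show ?thesis using False neighbours_sym by (simp add: fire_def)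
qed

lemma fires_to_laplacian:
  assumes "fires_to G D D'"
  shows "\<exists>f. \<forall>w. D' w = D w - laplacian f w"
  using assms unfolding fires_to_def
proof (induction rule: rtranclp_induct)
  case base
  have "laplacian (\<lambda>_. 0) w = 0" for w by (simp add: laplacian_def)
  then show ?case by (intro exI[of _ "\<lambda>_. 0"]) simp
next
  case (step D1 D2)
  then obtain f v where f: "\<forall>w. D1 w = D w - laplacian f w" and v: "D2 = fire G v D1" by blast
  then show ?case
    by (intro exI[of _ "\<lambda>u. f u + (if u = v then 1 else 0)"]) (simp add: fire_eq_laplacian laplacian_add)
qed

lemma equivalent_divisors_laplacian:
  assumes "equivalent_divisors G D D'"
  shows "\<exists>f. \<forall>w. D' w = D w - laplacian f w"
proof -
  consider "fires_to G D D'" | "fires_to G D' D"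
    using assms by (auto simp: equivalent_divisors_def)
  then show ?thesis
  proof cases
    case 2
    then obtain f where "\<forall>w. D w = D' w - laplacian f w" using fires_to_laplacian by blast
    then show ?thesis by (intro exI[of _ "\<lambda>u. - f u"]) (simp add: laplacian_uminus)
  qed (rule fires_to_laplacian)
qed

text \<open>The lower bound on the gonality uses equivalence only in this form: scripts, unlike
  firing sequences, can be negated and added.\<close>

lemma equivalent_to_effectiveD:
  assumes "equivalent_to_effective G D"
  shows "\<exists>f. \<forall>w \<in> V. laplacian f w \<le> D w"
proof -
  obtain D' where "effective G D'" "equivalent_divisors G D D'"
    using assms by (auto simp: equivalent_to_effective_def)
  moreover from this obtain f where "\<forall>w. D' w = D w - laplacian f w"
    using equivalent_divisors_laplacian by blast
  ultimately show ?thesis by (intro exI[of _ f]) (auto simp: effective_def)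
qed

lemma equivalent_to_effective_degree:
  assumes "equivalent_to_effective G D"
  shows "0 \<le> divisor_degree G D"
proof -
  obtain f where "\<forall>w \<in> V. laplacian f w \<le> D w" using equivalent_to_effectiveD[OF assms] by blast
  then have "(\<Sum>v \<in> V. laplacian f v) \<le> (\<Sum>v \<in> V. D v)" by (intro sum_mono) auto
  then show ?thesis by (simp add: sum_laplacian divisor_degree_def)
qed

section \<open>Divisors of rank at least one\<close>

lemma point_divisor:
  assumes "v \<in> V"
  shows "effective G (\<lambda>w. if w = v then int r else 0)"
    and "divisor_degree G (\<lambda>w. if w = v then int r else 0) = int r"
  using assms finite_vertices by (auto simp: effective_def divisor_def divisor_degree_def)

text \<open>The rank is a \<open>GREATEST\<close> over naturals, which is meaningful only for a
  bounded predicate. Taking all \<open>r\<close> chips from one vertex leaves degree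
  \<open>divisor_degree G D - r\<close>, and equivalence to an effective divisor forces this to be
  nonnegative.\<close>

lemma rank_property_bounded:
  assumes "V \<noteq> {}"
    and "\<forall>E. effective G E \<and> divisor_degree G E = int r \<longrightarrow>
      equivalent_to_effective G (\<lambda>v. D v - E v)"
  shows "r \<le> nat (divisor_degree G D)"
proof -
  obtain v where v: "v \<in> V" using assms by blast
  let ?E = "\<lambda>w. if w = v then int r else 0"
  have "0 \<le> divisor_degree G (\<lambda>w. D w - ?E w)"
    using assms(2) point_divisor[OF v] by (intro equivalent_to_effective_degree) blast
  also have "\<dots> = divisor_degree G D - divisor_degree G ?E"
    by (simp add: divisor_degree_def sum_subtractf)
  finally show ?thesis using point_divisor(2)[OF v] by simp
qed

text \<open>An effective divisor of degree 1 is a single chip, so testing each vertex once settles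
  the rank property for \<open>r = 1\<close>.\<close>

lemma divisor_rank_ge_1I:
  assumes "V \<noteq> {}" "equivalent_to_effective G D"
    and "\<And>v. v \<in> V \<Longrightarrow> equivalent_to_effective G (\<lambda>w. D w - (if w = v then 1 else 0))"
  shows "divisor_rank G D \<ge> 1"
proof -
  let ?P = "\<lambda>r. \<forall>E. effective G E \<and> divisor_degree G E = int r \<longrightarrow>
      equivalent_to_effective G (\<lambda>v. D v - E v)"
  have "?P 1"
  proof (intro allI impI, elim conjE)
    fix E assume E: "effective G E" "divisor_degree G E = int 1"
    then have sum: "(\<Sum>v \<in> V. E v) = 1" by (simp add: divisor_degree_def)
    have pos: "\<forall>v \<in> V. 0 \<le> E v" using E by (simp add: effective_def)
    obtain v where v: "v \<in> V" "E v > 0"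
      using sum pos by (metis less_le sum.neutral zero_neq_one)
    have "1 = E v + (\<Sum>w \<in> V - {v}. E w)"
      using sum sum.remove[OF finite_vertices v(1)] by metis
    moreover have "0 \<le> (\<Sum>w \<in> V - {v}. E w)" using pos by (intro sum_nonneg) auto
    ultimately have Ev: "E v = 1" and "(\<Sum>w \<in> V - {v}. E w) = 0" using v by linarith+
    then have "\<forall>w \<in> V - {v}. E w = 0"
      using pos finite_vertices by (subst (asm) sum_nonneg_eq_0_iff) auto
    then have "E = (\<lambda>w. if w = v then 1 else 0)"
      using E Ev by (fastforce simp: effective_def divisor_def)
    then show "equivalent_to_effective G (\<lambda>v. D v - E v)" using assms(3) v by simp
  qed
  then have "1 \<le> (GREATEST r. ?P r)"
    by (rule Greatest_le_nat) (rule rank_property_bounded[OF assms(1)])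
  then show ?thesis using assms(2) by (simp add: divisor_rank_def)
qed

lemma divisor_rank_ge_1D:
  assumes "V \<noteq> {}" "divisor_rank G D \<ge> 1"
  shows "\<exists>f. \<forall>w \<in> V. laplacian f w \<le> D w"
    and "v \<in> V \<Longrightarrow> \<exists>f. (\<forall>w \<in> V. laplacian f w \<le> D w) \<and> laplacian f v < D v"
proof -
  let ?P = "\<lambda>r. \<forall>E. effective G E \<and> divisor_degree G E = int r \<longrightarrow>
      equivalent_to_effective G (\<lambda>v. D v - E v)"
  have eff: "equivalent_to_effective G D"
    using assms by (metis divisor_rank_def neg_0_le_iff_le not_one_le_zero order_trans zero_le_one)
  then show "\<exists>f. \<forall>w \<in> V. laplacian f w \<le> D w" by (rule equivalent_to_effectiveD)
  define r where "r = (GREATEST r. ?P r)"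
  have r1: "r \<ge> 1" using assms eff by (simp add: divisor_rank_def r_def)
  \<comment> \<open>A bounded predicate attains its maximum once it has an instance; for
    \<open>r = 0\<close> only the zero divisor is tested.\<close>
  have "?P 0"
  proof (intro allI impI, elim conjE)
    fix E assume E: "effective G E" "divisor_degree G E = int 0"
    then have "\<forall>v \<in> V. E v = 0"
      using finite_vertices by (simp add: effective_def divisor_degree_def sum_nonneg_eq_0_iff)
    then have "E = (\<lambda>w. 0)" using E by (auto simp: effective_def divisor_def)
    then show "equivalent_to_effective G (\<lambda>v. D v - E v)" using eff by simp
  qed
  then have "?P r" unfolding r_def
    by (rule GreatestI_nat) (rule rank_property_bounded[OF assms(1)])
  fix v assume "v \<in> V"
  with \<open>?P r\<close> have "equivalent_to_effective G (\<lambda>w. D w - (if w = v then int r else 0))"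
    using point_divisor by blast
  \<comment> \<open>All \<open>r\<close> chips were placed on \<open>v\<close>; as
    \<open>r \<ge> 1\<close>, the inequality at \<open>v\<close> becomes strict.\<close>
  then obtain f where f: "\<forall>w \<in> V. laplacian f w \<le> D w - (if w = v then int r else 0)"
    using equivalent_to_effectiveD by blast
  show "\<exists>f. (\<forall>w \<in> V. laplacian f w \<le> D w) \<and> laplacian f v < D v"
  proof (intro exI[of _ f] conjI ballI)
    show "laplacian f w \<le> D w" if "w \<in> V" for w
      using f that by (smt (verit) of_nat_0_le_iff)
    show "laplacian f v < D v" using f \<open>v \<in> V\<close> r1 by fastforce
  qed
qed

section \<open>Edge boundaries, eggs and egg-cuts\<close>

lemma boundary_eq: "W \<subseteq> V \<Longrightarrow> boundary W = {(v, w). v \<in> W \<and> w \<in> V - W \<and> adjacent G v w}"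
  using adjacentD by (auto simp: boundary_def mem_neighbours)

lemma card_boundary: "W \<subseteq> V \<Longrightarrow> card (boundary W) = (\<Sum>v \<in> W. card (neighbours G v - W))"
  unfolding boundary_def using finite_vertices finite_neighbours
  by (intro card_SigmaI) (auto intro: finite_subset)

lemma card_boundary_complement:
  assumes "W \<subseteq> V"
  shows "card (boundary (V - W)) = card (boundary W)"
proof -
  have "boundary (V - W) = prod.swap ` boundary W"
    using assms adjacent_commute by (fastforce simp: boundary_eq)
  then show ?thesis by (simp add: card_image)
qed

lemma egg_in_independent_set:
  assumes "independent I" "egg G U" "U \<subseteq> I"
  shows "\<exists>v. U = {v}"
proof -
  have "u = v" if "u \<in> U" "v \<in> U" for u v
  proof (rule ccontr)
    assume "u \<noteq> v"
    moreover have "(adjacent (induced_sgraph G U))\<^sup>*\<^sup>* u v"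
      using assms that by (auto simp: egg_def connected_sgraph_def induced_sgraph_def)
    ultimately obtain w where "adjacent (induced_sgraph G U) u w"
      by (metis converse_rtranclpE)
    then show False using assms by (auto simp: adjacent_def induced_sgraph_def independent_def)
  qed
  moreover have "U \<noteq> {}" using assms by (simp add: egg_def)
  ultimately show ?thesis by blast
qed

text \<open>Without the edges at \<open>v\<close>, the vertex \<open>v\<close> is a component of its
  own, while \<open>U\<close> stays connected because its inner edges avoid
  \<open>v\<close>.\<close>

lemma egg_cut_star:
  assumes "{v} \<in> S" "U \<in> S" "v \<notin> U" "egg G {v}" "egg G U"
  shows "egg_cut G S {e \<in> edges G. v \<in> e}"
    and "card {e \<in> edges G. v \<in> e} \<le> card (neighbours G v)"
proof -
  let ?C = "{e \<in> edges G. v \<in> e}"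
  let ?H = "delete_edges G ?C"
  have v: "v \<in> V" and U: "U \<subseteq> V" "U \<noteq> {}" using assms by (auto simp: egg_def)
  obtain u where u: "u \<in> U" using U by blast
  define Y where "Y = {w \<in> V. (adjacent ?H)\<^sup>*\<^sup>* u w}"
  have H: "vertices ?H = V" by (simp add: delete_edges_def)
  have "\<not> adjacent ?H v w" for w by (simp add: delete_edges_def adjacent_def)
  then have "w = v" if "(adjacent ?H)\<^sup>*\<^sup>* v w" for w using that by (metis converse_rtranclpE)
  then have "{w \<in> V. (adjacent ?H)\<^sup>*\<^sup>* v w} = {v}" using v by blast
  then have "{v} \<in> components ?H"
    unfolding components_def H mem_Collect_eq using v by (intro exI[of _ v]) simp
  moreover have "Y \<in> components ?H"
    unfolding components_def H Y_def mem_Collect_eq using u U by (intro exI[of _ u]) auto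
  moreover have "U \<subseteq> Y"
  proof
    fix w assume w: "w \<in> U"
    have "(adjacent (induced_sgraph G U))\<^sup>*\<^sup>* u w"
      using assms u w by (auto simp: egg_def connected_sgraph_def induced_sgraph_def)
    moreover have "adjacent ?H x y" if "adjacent (induced_sgraph G U) x y" for x y
      using assms(3) that by (auto simp: adjacent_def induced_sgraph_def delete_edges_def)
    ultimately have "(adjacent ?H)\<^sup>*\<^sup>* u w" by (rule rtranclp_mono[THEN predicate2D, OF predicate2I, rotated])
    then show "w \<in> Y" using w U by (auto simp: Y_def)
  qed
  moreover have "{v} \<noteq> Y" using \<open>U \<subseteq> Y\<close> u assms(3) by auto
  ultimately show "egg_cut G S ?C"
    unfolding egg_cut_def using assms(1,2) by (metis (mono_tags, lifting) mem_Collect_eq order_refl subsetI)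
  have "?C \<subseteq> (\<lambda>w. {v, w}) ` neighbours G v"
  proof clarify
    fix e assume "e \<in> edges G" "v \<in> e"
    then obtain w where "e = {v, w}" using edge_ends by blast
    then show "e \<in> (\<lambda>w. {v, w}) ` neighbours G v"
      using \<open>e \<in> edges G\<close> by (auto simp: mem_neighbours adjacent_def)
  qed
  then show "card ?C \<le> card (neighbours G v)"
    using finite_neighbours by (meson surj_card_le)
qed

lemma scramble_order_le:
  assumes "independent I" "I \<noteq> V" "scramble G S"
  shows "scramble_order G S \<le> enat (card V - card I)"
proof -
  have I: "I \<subseteq> V" "finite I" using assms finite_vertices by (auto simp: independent_def intro: finite_subset)
  have card: "card (V - I) = card V - card I" using I by (simp add: card_Diff_subset)
  have hit: "scramble_order G S \<le> enat (card H)" if "hitting_set G S H" for H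
  proof -
    have "hitting_number G S \<le> card H" unfolding hitting_number_def using that by (intro Least_le) blast
    then show ?thesis by (simp add: scramble_order_def min.coboundedI1)
  qed
  show ?thesis
  proof (cases "hitting_set G S (V - I)")
    case True
    then show ?thesis using hit card by metis
  next
    case False
    then obtain U where U: "U \<in> S" "U \<subseteq> I"
      using assms by (auto simp: hitting_set_def scramble_def egg_def)
    moreover have egg: "\<And>U. U \<in> S \<Longrightarrow> egg G U" using assms by (simp add: scramble_def)
    ultimately obtain v where v: "U = {v}" using egg_in_independent_set assms(1) by metis
    show ?thesis
    \<comment> \<open>If \<open>{v}\<close> hits every egg, the order is at most 1, and
      \<open>I \<noteq> V\<close> makes the claimed bound positive. Otherwise the edges at
      \<open>v\<close> separate \<open>{v}\<close> from an egg avoiding \<open>v\<close>, and their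
      other ends all lie outside \<open>I\<close>.\<close>
    proof (cases "hitting_set G S {v}")
      case True
      have "card (V - I) > 0" using assms I finite_vertices by (auto simp: card_gt_0_iff)
      then have "enat (card {v}) \<le> enat (card V - card I)" using card by simp
      then show ?thesis using hit[OF True] order_trans by blast
    next
      case False
      then obtain U' where U': "U' \<in> S" "v \<notin> U'"
        using v U I by (auto simp: hitting_set_def)
      note cut = egg_cut_star[of v S U']
      have "egg_cut_number G S \<le> enat (card {e \<in> edges G. v \<in> e})"
        unfolding egg_cut_number_def using cut(1) U U' v egg by (intro INF_lower) auto
      also have "\<dots> \<le> enat (card (neighbours G v))" using cut(2) U U' v egg by simp
      also have "neighbours G v \<subseteq> V - I"
        using assms U v adjacentD by (auto simp: independent_def mem_neighbours)
      then have "enat (card (neighbours G v)) \<le> enat (card V - card I)"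
        using finite_vertices card by (metis card_mono enat_ord_simps(1) finite_Diff)
      finally show ?thesis by (simp add: scramble_order_def min.coboundedI2)
    qed
  qed
qed

text \<open>An edge leaving a component must have been deleted; having only one end in
  \<open>X\<close>, it determines its outward orientation.\<close>

lemma boundary_component_le:
  assumes C: "C \<subseteq> edges G" and X: "X \<in> components (delete_edges G C)"
  shows "card (boundary X) \<le> card C"
proof -
  have XV: "X \<subseteq> V" using X by (auto simp: components_def delete_edges_def)
  have fin: "finite C" using C finite_edges by (rule finite_subset)
  have sub: "(\<lambda>(v, w). {v, w}) ` boundary X \<subseteq> C"
  proof clarify
    fix v w assume "(v, w) \<in> boundary X"
    then have vw: "v \<in> X" "w \<in> V" "w \<notin> X" "{v, w} \<in> edges G"
      using XV by (auto simp: boundary_eq adjacent_def)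
    show "{v, w} \<in> C"
    proof (rule ccontr)
      assume "{v, w} \<notin> C"
      then have "adjacent (delete_edges G C) v w" using vw by (simp add: adjacent_def delete_edges_def)
      then show False
        using X vw by (auto simp: components_def delete_edges_def intro: rtranclp.rtrancl_into_rtrancl)
    qed
  qed
  have "inj_on (\<lambda>(v, w). {v, w}) (boundary X)"
    using XV by (auto simp: inj_on_def boundary_eq doubleton_eq_iff)
  then show ?thesis using card_inj_on_le[OF _ sub fin] by blast
qed

lemma components_disjoint:
  assumes "X \<in> components (delete_edges G C)" "Y \<in> components (delete_edges G C)" "X \<noteq> Y"
  shows "X \<inter> Y = {}"
proof (rule ccontr)
  let ?R = "(adjacent (delete_edges G C))\<^sup>*\<^sup>*"
  assume "X \<inter> Y \<noteq> {}"
  then obtain z where z: "z \<in> X" "z \<in> Y" by blast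
  have sym: "?R u v \<Longrightarrow> ?R v u" for u v
    by (rule sympD[OF symp_rtranclp]) (auto simp: symp_def adjacent_def insert_commute)
  obtain a where a: "X = {v \<in> V. ?R a v}" using assms(1) by (auto simp: components_def delete_edges_def)
  obtain b where b: "Y = {v \<in> V. ?R b v}" using assms(2) by (auto simp: components_def delete_edges_def)
  have "?R a b" "?R b a" using z a b sym by (auto intro: rtranclp_trans)
  then have "X = Y" using a b by (auto intro: rtranclp_trans)
  then show False using assms(3) by simp
qed

lemma egg_edge:
  assumes "e \<in> edges G"
  shows "egg G e"
proof -
  obtain u v where uv: "u \<in> V" "v \<in> V" "e = {u, v}" using edge_ends assms by blast
  then have "adjacent (induced_sgraph G e) u v" "adjacent (induced_sgraph G e) v u"
    using assms by (auto simp: adjacent_def induced_sgraph_def insert_commute)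
  then show ?thesis using uv by (auto simp: egg_def connected_sgraph_def induced_sgraph_def)
qed

section \<open>Upper bound for the gonality\<close>

lemma gonality_upper:
  assumes I: "independent I" and "V \<noteq> {}" and deg: "\<And>v. v \<in> V \<Longrightarrow> neighbours G v \<noteq> {}"
  shows "\<exists>D. divisor G D \<and> divisor_rank G D \<ge> 1 \<and> divisor_degree G D = int (card V) - int (card I)"
proof -
  define D :: "'a \<Rightarrow> int" where "D = (\<lambda>v. if v \<in> V - I then 1 else 0)"
  have sub: "I \<subseteq> V" using I by (simp add: independent_def)
  have eff: "effective G D" by (auto simp: D_def effective_def divisor_def)
  have refl: "equivalent_divisors G E E" for E by (simp add: equivalent_divisors_def fires_to_def)
  have "divisor_degree G D = int (card (V - I))"
    using finite_vertices by (simp add: divisor_degree_def D_def sum.If_cases set_diff_eq Collect_conj_eq)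
  also have "\<dots> = int (card V) - int (card I)"
    using sub finite_vertices
    by (simp add: card_Diff_subset finite_subset of_nat_diff card_mono)
  finally have degree: "divisor_degree G D = int (card V) - int (card I)" .
  have "divisor_rank G D \<ge> 1"
  proof (rule divisor_rank_ge_1I)
    show "equivalent_to_effective G D" using eff refl by (auto simp: equivalent_to_effective_def)
    fix v assume v: "v \<in> V"
    define D1 where "D1 = (\<lambda>w. D w - (if w = v then 1 else 0))"
    \<comment> \<open>In \<open>D'\<close> the vertex \<open>v\<close> has borrowed a chip from each
      neighbour; firing \<open>v\<close> gives back \<open>D1\<close>, so the equivalence runs from
      \<open>D'\<close> to \<open>D1\<close>. For \<open>v\<close> in \<open>I\<close> all
      neighbours lie outside \<open>I\<close> and can spare their chip, and at least one neighbour
      exists to cover the missing chip at \<open>v\<close>.\<close>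
    define D' where "D' = (\<lambda>w. D1 w + laplacian (\<lambda>u. if u = v then 1 else 0) w)"
    have fire: "fire G v D' = D1" by (rule ext) (simp add: fire_eq_laplacian D'_def)
    show "equivalent_to_effective G (\<lambda>w. D w - (if w = v then 1 else 0))"
    proof (cases "v \<in> I")
      case False
      then have "effective G D1" using v by (auto simp: D1_def D_def effective_def divisor_def)
      then show ?thesis using refl by (auto simp: equivalent_to_effective_def D1_def)
    next
      case True
      have val: "D' w = D w - (if w = v then 1 else 0)
          + (if w = v then int (card (neighbours G v)) else if w \<in> neighbours G v then - 1 else 0)" for w
        using fun_cong[OF fire, of w] neighbours_subset[of v]
        by (auto simp: fire_def D1_def split: if_splits)
      have "neighbours G v \<subseteq> V - I"
        using I True adjacentD by (auto simp: independent_def mem_neighbours)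
      moreover have "card (neighbours G v) \<ge> 1"
        using deg[OF v] finite_neighbours by (simp add: Suc_le_eq card_gt_0_iff)
      ultimately have "effective G D'"
        using v neighbours_subset by (auto simp: effective_def divisor_def val D_def)
      moreover have "fires_to G D' D1"
        unfolding fires_to_def using v fire by (intro r_into_rtranclp) blast
      ultimately show ?thesis
        by (auto simp: equivalent_to_effective_def equivalent_divisors_def D1_def)
    qed
  qed (fact assms)
  moreover have "divisor G D" using eff by (simp add: effective_def)
  ultimately show ?thesis using degree by blast
qed

end

section \<open>Graphs with all degrees above half the number of vertices\<close>

locale dense_sgraph = simple_sgraph +
  fixes d :: nat
  assumes degree_ge: "v \<in> V \<Longrightarrow> d \<le> card (neighbours G v)"
    and dense: "card V < 2 * d"
    and nonempty: "V \<noteq> {}"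
begin

lemma card_boundary_ge_small:
  assumes W: "W \<subseteq> V" "2 \<le> card W" "2 * card W \<le> card V"
  shows "card V - 1 \<le> card (boundary W)"
proof -
  have finW: "finite W" using W finite_vertices by (auto intro: finite_subset)
  have "d - (card W - 1) \<le> card (neighbours G v - W)" if v: "v \<in> W" for v
  proof -
    have "card (neighbours G v) \<le> card ((neighbours G v - W) \<union> (W - {v}))"
      using finW finite_neighbours neighbours_subset[of v] by (intro card_mono) auto
    also have "\<dots> \<le> card (neighbours G v - W) + (card W - 1)"
      using card_Un_le[of "neighbours G v - W" "W - {v}"] v finW by simp
    finally show ?thesis using degree_ge[of v] v W by force
  qed
  then have "card W * (d - (card W - 1)) \<le> card (boundary W)"
    using sum_bounded_below[of W "d - (card W - 1)" "\<lambda>v. card (neighbours G v - W)"]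
    by (simp add: card_boundary W)
  \<comment> \<open>With \<open>card W = x + 2\<close> and \<open>d = x + 3 + y\<close> the bound
    reads \<open>(x + 2) * (y + 2)\<close>, which exceeds \<open>2 * d - 2\<close> by
    \<open>x * y\<close>; and \<open>card V - 1 \<le> 2 * d - 2\<close>.\<close>
  moreover obtain x where x: "card W = x + 2" using W(2) le_Suc_ex by (metis add.commute)
  moreover have "card W + 1 \<le> d" using dense W(3) by linarith
  then obtain y where y: "d = x + 3 + y" using x le_Suc_ex by fastforce
  moreover have "card V \<le> 2 * x + 2 * y + 5" using dense y by linarith
  moreover have "(x + 2) * (y + 2) = x * y + (2 * x + 2 * y + 4)" by (simp add: algebra_simps)
  moreover have "d - (card W - 1) = y + 2" using x y by simp
  ultimately have "2 * x + 2 * y + 4 \<le> card (boundary W)" by simp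
  then show ?thesis using \<open>card V \<le> 2 * x + 2 * y + 5\<close> by linarith
qed

lemma card_boundary_ge:
  assumes "W \<subseteq> V" "2 \<le> card W" "2 \<le> card (V - W)"
  shows "card V - 1 \<le> card (boundary W)"
proof (cases "2 * card W \<le> card V")
  case True
  then show ?thesis using assms card_boundary_ge_small by blast
next
  case False
  then have "2 * card (V - W) \<le> card V"
    using assms finite_vertices by (simp add: card_Diff_subset finite_subset)
  then show ?thesis
    using assms card_boundary_ge_small[of "V - W"] card_boundary_complement by simp
qed

text \<open>A hitting set of the edges is a vertex cover, so its complement is independent. Two
  components that each contain an edge have at least two vertices each, which brings the boundary
  bound into play.\<close>

lemma scramble_order_edges_ge:
  assumes alpha: "\<And>J. independent J \<Longrightarrow> card J \<le> a" and "a \<ge> 1"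
  shows "scramble_order G (edges G) \<ge> enat (card V - a)"
proof -
  have "card V - a \<le> hitting_number G (edges G)"
  proof -
    have "hitting_set G (edges G) V" using edge_ends by (fastforce simp: hitting_set_def)
    then have "\<exists>m H. hitting_set G (edges G) H \<and> card H = m" by blast
    then have "\<exists>H. hitting_set G (edges G) H \<and> card H = hitting_number G (edges G)"
      unfolding hitting_number_def by (rule LeastI_ex)
    then obtain H where H: "hitting_set G (edges G) H" "card H = hitting_number G (edges G)" by blast
    then have "independent (V - H)"
      by (fastforce simp: independent_def hitting_set_def adjacent_def)
    then have "card (V - H) \<le> a" by (rule alpha)
    then show ?thesis using H diff_card_le_card_Diff[of H V] finite_vertices
      by (force simp: hitting_set_def dest: finite_subset)
  qed
  moreover have "enat (card V - a) \<le> egg_cut_number G (edges G)"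
    unfolding egg_cut_number_def
  proof (rule INF_greatest, clarsimp simp: egg_cut_def)
    fix C X Y e e'
    assume C: "C \<subseteq> edges G" and X: "X \<in> components (delete_edges G C)"
      and Y: "Y \<in> components (delete_edges G C)" and ne: "X \<noteq> Y"
      and e: "e \<in> edges G" "e \<subseteq> X" "e' \<in> edges G" "e' \<subseteq> Y"
    have XY: "X \<subseteq> V" "Y \<subseteq> V" using X Y by (auto simp: components_def delete_edges_def)
    have two: "2 \<le> card A" if "f \<in> edges G" "f \<subseteq> A" "A \<subseteq> V" for f A
    proof -
      have "card f = 2" using edge_ends[OF that(1)] by auto
      then show ?thesis using that finite_vertices by (metis card_mono finite_subset)
    qed
    have "Y \<subseteq> V - X" using components_disjoint[OF X Y ne] XY by blast
    then have "card V - 1 \<le> card (boundary X)"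
      using e XY two by (intro card_boundary_ge) (auto intro: two)
    also have "\<dots> \<le> card C" using C X by (rule boundary_component_le)
    finally show "card V - a \<le> card C" using \<open>a \<ge> 1\<close> by simp
  qed
  ultimately show ?thesis by (simp add: scramble_order_def)
qed

lemma scramble_number_eq:
  assumes I: "independent I" and max: "\<And>J. independent J \<Longrightarrow> card J \<le> card I"
    and "I \<noteq> {}" "I \<noteq> V"
  shows "scramble_number G = card V - card I"
proof -
  have scr: "scramble G (edges G)" using finite_edges egg_edge by (simp add: scramble_def)
  have "finite I" using I finite_vertices by (auto simp: independent_def intro: finite_subset)
  then have "card I \<ge> 1" using \<open>I \<noteq> {}\<close> by (simp add: Suc_le_eq card_gt_0_iff)
  then have "scramble_order G (edges G) = enat (card V - card I)"
    using scramble_order_edges_ge[OF max] scramble_order_le[OF I \<open>I \<noteq> V\<close> scr] by (intro antisym) auto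
  then show ?thesis unfolding scramble_number_def
    using scr scramble_order_le[OF I \<open>I \<noteq> V\<close>] by (intro Greatest_equality) fastforce+
qed

text \<open>The top level set of a firing script that moves a chip onto an end of an edge without chips
  has a small boundary, hence is a single vertex, and that vertex pays for its own firing.\<close>

lemma exists_firable_vertex:
  assumes alpha: "\<And>J. independent J \<Longrightarrow> card J \<le> a" and "a \<ge> 1"
    and eff: "\<And>w. w \<in> V \<Longrightarrow> 0 \<le> D w"
    and small: "(\<Sum>w \<in> V. D w) < int (card V) - int a"
    and rank: "\<And>v. v \<in> V \<Longrightarrow> \<exists>f. (\<forall>w \<in> V. laplacian f w \<le> D w) \<and> laplacian f v < D v"
  shows "\<exists>p \<in> V. int (card (neighbours G p)) \<le> D p"
proof -
  \<comment> \<open>Fewer than \<open>card V - a\<close> chips leave more than \<open>a\<close>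
    vertices without a chip, too many to be independent. This yields an edge with both ends
    \<open>A\<close> and \<open>B\<close> empty.\<close>
  define Z where "Z = {v \<in> V. D v = 0}"
  have "int (card (V - Z)) = (\<Sum>w \<in> V - Z. 1)" by simp
  also have "\<dots> \<le> (\<Sum>w \<in> V - Z. D w)" using eff by (intro sum_mono) (force simp: Z_def)
  also have "\<dots> \<le> (\<Sum>w \<in> V. D w)" using eff finite_vertices by (intro sum_mono2) auto
  finally have "int (card (V - Z)) < int (card V) - int a" using small by linarith
  moreover have "card (V - Z) + card Z = card V"
    using finite_vertices by (simp add: Z_def card_Diff_subset card_mono)
  ultimately have "card Z > a" by linarith
  then have "\<not> independent Z" using alpha[of Z] by linarith
  then obtain A B where AB: "adjacent G A B" "A \<in> V" "B \<in> V" "D A = 0" "D B = 0"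
    by (auto simp: independent_def Z_def)
  obtain f where f: "\<And>w. w \<in> V \<Longrightarrow> laplacian f w \<le> D w" "laplacian f A < 0"
    using rank[OF AB(2)] AB(4) by metis
  define m where "m = Max (f ` V)"
  define U where "U = {v \<in> V. f v = m}"
  have le: "f v \<le> m" if "v \<in> V" for v using that finite_vertices by (simp add: m_def)
  have "m \<in> f ` V" unfolding m_def using finite_vertices nonempty by (intro Max_in) auto
  then have "U \<noteq> {}" by (auto simp: U_def)
  have nbrV: "w \<in> V" if "w \<in> neighbours G v" for v w using that neighbours_subset by auto
  \<comment> \<open>A top vertex loses at least one chip to each neighbour below the top level and
    gains none.\<close>
  have lap_top: "int (card (neighbours G v - U)) \<le> laplacian f v" if v: "v \<in> U" for v
  proof -
    have "int (card (neighbours G v - U)) = (\<Sum>w \<in> neighbours G v - U. 1)" by simp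
    also have "\<dots> \<le> (\<Sum>w \<in> neighbours G v - U. f v - f w)"
      using v le nbrV by (intro sum_mono) (force simp: U_def)
    also have "\<dots> \<le> laplacian f v" unfolding laplacian_def
      using v le nbrV finite_neighbours by (intro sum_mono2) (auto simp: U_def)
    finally show ?thesis .
  qed
  have AU: "A \<notin> U" using lap_top[of A] f(2) by linarith
  have UV: "U \<subseteq> V" "finite U" using finite_vertices by (auto simp: U_def)
  have "int (card (boundary U)) = (\<Sum>v \<in> U. int (card (neighbours G v - U)))"
    using UV by (simp add: card_boundary)
  also have "\<dots> \<le> (\<Sum>v \<in> U. D v)" using order_trans[OF lap_top f(1)] UV by (intro sum_mono) blast
  also have "\<dots> \<le> (\<Sum>v \<in> V. D v)" using eff UV finite_vertices by (intro sum_mono2) auto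
  finally have "\<not> card V - 1 \<le> card (boundary U)" using small \<open>a \<ge> 1\<close> by linarith
  then have "card U < 2 \<or> card (V - U) < 2" using card_boundary_ge[OF UV(1)] by linarith
  moreover have "card U > 0" using \<open>U \<noteq> {}\<close> UV by (simp add: card_gt_0_iff)
  moreover have "card (V - U) > 0" using AU AB finite_vertices by (auto simp: card_gt_0_iff)
  ultimately have "card U = 1 \<or> card (V - U) = 1" by linarith
  then show ?thesis
  proof
    assume "card U = 1"
    then obtain p where p: "U = {p}" by (auto simp: card_1_singleton_iff)
    then have "p \<in> V" using UV by auto
    moreover have "neighbours G p - U = neighbours G p" using p neighbours_subset by blast
    ultimately show ?thesis using order_trans[OF lap_top f(1), of p] p by auto
  next
    \<comment> \<open>If only \<open>A\<close> lies below the top, its neighbour \<open>B\<close>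
      would have to lose a chip to \<open>A\<close>, but \<open>B\<close> has none.\<close>
    assume "card (V - U) = 1"
    then have VU: "V - U = {A}" using AU AB by (metis DiffI card_1_singletonE singletonD)
    have "B \<in> U" using VU AB(3) adjacentD[OF AB(1)] by (metis DiffI singletonD)
    moreover have "A \<in> neighbours G B - U" using adjacent_sym[OF AB(1)] AU by (simp add: mem_neighbours)
    then have "card (neighbours G B - U) > 0" using finite_neighbours by (auto simp: card_gt_0_iff)
    ultimately have False using lap_top[of B] f(1)[of B] AB by linarith
    then show ?thesis ..
  qed
qed

text \<open>Firing \<open>p\<close> puts a chip on each of its neighbours; the next firable vertex \<open>q\<close> is then a
  different one, and together they account for at least \<open>2 d - 1\<close> chips.\<close>

lemma gonality_lower:
  assumes alpha: "\<And>J. independent J \<Longrightarrow> card J \<le> a" and "a \<ge> 1"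
    and rank: "divisor_rank G D \<ge> 1"
  shows "int (card V) - int a \<le> divisor_degree G D"
proof (rule ccontr)
  assume "\<not> ?thesis"
  then have small: "(\<Sum>w \<in> V. D w) < int (card V) - int a" by (simp add: divisor_degree_def)
  \<comment> \<open>The rank condition passes to every effective \<open>D - laplacian g\<close>:
    subtract \<open>g\<close> from the scripts that serve \<open>D\<close>.\<close>
  have shifted: "\<exists>p \<in> V. int (card (neighbours G p)) \<le> D p - laplacian g p"
    if g: "\<And>w. w \<in> V \<Longrightarrow> laplacian g w \<le> D w" for g
  proof (rule exists_firable_vertex[OF alpha \<open>a \<ge> 1\<close>])
    show "(\<Sum>w \<in> V. D w - laplacian g w) < int (card V) - int a"
      using small by (simp add: sum_subtractf sum_laplacian)
    fix v assume "v \<in> V"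
    then obtain f where f: "\<forall>w \<in> V. laplacian f w \<le> D w" "laplacian f v < D v"
      using divisor_rank_ge_1D(2)[OF nonempty rank] by blast
    have "laplacian (\<lambda>u. f u + - g u) w = laplacian f w - laplacian g w" for w
      unfolding laplacian_add laplacian_uminus by simp
    then show "\<exists>f. (\<forall>w \<in> V. laplacian f w \<le> D w - laplacian g w) \<and> laplacian f v < D v - laplacian g v"
      using f by (intro exI[of _ "\<lambda>u. f u + - g u"]) simp
  next
    show "0 \<le> D w - laplacian g w" if "w \<in> V" for w using g[OF that] by simp
  qed
  obtain g where g: "\<And>w. w \<in> V \<Longrightarrow> laplacian g w \<le> D w"
    using divisor_rank_ge_1D(1)[OF nonempty rank] by blast
  obtain p where p: "p \<in> V" "int (card (neighbours G p)) \<le> D p - laplacian g p"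
    using shifted[OF g] by blast
  define E where "E = fire G p (\<lambda>w. D w - laplacian g w)"
  define h where "h = (\<lambda>u. g u + (if u = p then 1 else 0))"
  have Eh: "E w = D w - laplacian h w" for w
    unfolding E_def h_def fire_eq_laplacian laplacian_add by simp
  have Ep: "E p = D p - laplacian g p - int (card (neighbours G p))"
    by (simp add: E_def fire_def)
  have Enbr: "E w \<ge> 1" if "w \<in> neighbours G p" for w
    using that g[of w] neighbours_subset[of p] by (auto simp: E_def fire_def)
  have E0: "E w \<ge> 0" if "w \<in> V" for w
    using that g[of w] p by (auto simp: E_def fire_def)
  have Esum: "(\<Sum>w \<in> V. E w) < int (card V) - int a"
    using small by (simp add: Eh sum_subtractf sum_laplacian)
  have "laplacian h w \<le> D w" if "w \<in> V" for w using E0[OF that] Eh[of w] by linarith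
  then obtain q where q: "q \<in> V" "int (card (neighbours G q)) \<le> E q"
    using shifted[of h] Eh by auto
  \<comment> \<open>Leaving \<open>q\<close> out keeps it from being counted twice should it be a
    neighbour of \<open>p\<close>; the other neighbours still hold at least \<open>d - 1\<close>
    chips, and \<open>q\<close> holds at least \<open>d\<close>.\<close>
  have "int (card (neighbours G p - {q})) = (\<Sum>w \<in> neighbours G p - {q}. 1)" by simp
  also have "\<dots> \<le> (\<Sum>w \<in> neighbours G p - {q}. E w)" using Enbr by (intro sum_mono) auto
  finally have "int (card (neighbours G p - {q})) + E q
      \<le> (\<Sum>w \<in> neighbours G p - {q}. E w) + E q" by simp
  also have "\<dots> = (\<Sum>w \<in> insert q (neighbours G p - {q}). E w)"
    using finite_neighbours by (subst sum.insert) auto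
  also have "\<dots> \<le> (\<Sum>w \<in> V. E w)"
    using finite_vertices neighbours_subset q E0 by (intro sum_mono2) auto
  finally have "int (card (neighbours G p - {q})) + int (card (neighbours G q))
      < int (card V) - int a" using q Esum by linarith
  moreover have "card (neighbours G p) - 1 \<le> card (neighbours G p - {q})"
    using finite_neighbours by (metis card_Diff_singleton_if diff_le_self le_refl)
  ultimately show False
    using degree_ge[OF p(1)] degree_ge[OF q(1)] dense \<open>a \<ge> 1\<close> by linarith
qed

lemma gonality_eq:
  assumes I: "independent I" and max: "\<And>J. independent J \<Longrightarrow> card J \<le> card I" and "I \<noteq> {}"
  shows "gonality G = int (card V) - int (card I)"
  unfolding gonality_def
proof (rule Least_equality)
  have "neighbours G v \<noteq> {}" if "v \<in> V" for v
    using degree_ge[OF that] dense by auto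
  then show "\<exists>D. divisor G D \<and> divisor_rank G D \<ge> 1 \<and> divisor_degree G D = int (card V) - int (card I)"
    using I nonempty by (intro gonality_upper)
  have "finite I" using I finite_vertices by (auto simp: independent_def intro: finite_subset)
  then have "card I \<ge> 1" using \<open>I \<noteq> {}\<close> by (simp add: Suc_le_eq card_gt_0_iff)
  then show "int (card V) - int (card I) \<le> y"
    if "\<exists>D. divisor G D \<and> divisor_rank G D \<ge> 1 \<and> divisor_degree G D = y" for y
    using that gonality_lower[OF max] by auto
qed

end

subsection \<open>Intersecting families\<close>

definition uniform_family :: "nat \<Rightarrow> nat \<Rightarrow> nat set set \<Rightarrow> bool" where
  "uniform_family n k F \<longleftrightarrow> F \<subseteq> {A. A \<subseteq> {1..n} \<and> card A = k}"

definition intersecting_family :: "nat \<Rightarrow> 'a set set \<Rightarrow> bool" where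
  "intersecting_family t F \<longleftrightarrow> (\<forall>A \<in> F. \<forall>B \<in> F. t \<le> card (A \<inter> B))"

section \<open>Shifting of set families\<close>

definition exchange :: "'a \<Rightarrow> 'a \<Rightarrow> 'a set \<Rightarrow> 'a set" where
  "exchange i j A = insert i (A - {j})"

text \<open>The exchange is suppressed when its result is already a member; this keeps the map
  injective on \<open>F\<close>.\<close>

definition shift :: "'a set set \<Rightarrow> 'a \<Rightarrow> 'a \<Rightarrow> 'a set \<Rightarrow> 'a set" where
  "shift F i j A = (if j \<in> A \<and> i \<notin> A \<and> exchange i j A \<notin> F then exchange i j A else A)"

definition shifted :: "nat set set \<Rightarrow> bool" where
  "shifted F \<longleftrightarrow> (\<forall>A \<in> F. \<forall>i j. 1 \<le> i \<and> i < j \<and> j \<in> A \<and> i \<notin> A \<longrightarrow> exchange i j A \<in> F)"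

lemma finite_subsets_card: "finite S \<Longrightarrow> finite {A. A \<subseteq> S \<and> P A}"
  by (rule finite_subset[of _ "Pow S"]) auto

lemma uniform_familyD:
  assumes "uniform_family n k F" "A \<in> F"
  shows "A \<subseteq> {1..n}" "finite A" "card A = k"
  using assms finite_subset[of A "{1..n}"] by (auto simp: uniform_family_def)

lemma uniform_family_finite: "uniform_family n k F \<Longrightarrow> finite F"
  unfolding uniform_family_def by (rule finite_subset) (auto intro: finite_subsets_card)

lemma card_exchange: "finite A \<Longrightarrow> j \<in> A \<Longrightarrow> i \<notin> A \<Longrightarrow> card (exchange i j A) = card A"
  by (metis Diff_iff card.remove card_insert_disjoint exchange_def finite_Diff)

text \<open>A moved set lands outside \<open>F\<close>, an unmoved one stays inside, and exchanging
  back undoes a move.\<close>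

lemma inj_on_shift: "inj_on (shift F i j) F"
proof (rule inj_onI)
  fix A B assume AB: "A \<in> F" "B \<in> F" "shift F i j A = shift F i j B"
  have inv: "exchange j i (exchange i j A) = A" if "j \<in> A" "i \<notin> A" for A
    unfolding exchange_def using that by blast
  have alt: "shift F i j A = A \<or> shift F i j A = exchange i j A \<and> j \<in> A \<and> i \<notin> A" for A
    by (simp add: shift_def)
  have stay: "shift F i j A = A" if "shift F i j A \<in> F" for A
    using that by (metis shift_def)
  consider "shift F i j A = A" | "shift F i j B = B"
    | "exchange i j A = exchange i j B" "j \<in> A" "i \<notin> A" "j \<in> B" "i \<notin> B"
    using AB(3) alt[of A] alt[of B] by metis
  then show "A = B"
  proof cases
    case 1
    with AB stay[of B] show ?thesis by simp
  next
    case 2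
    with AB stay[of A] show ?thesis by simp
  next
    case 3
    then have "exchange j i (exchange i j A) = exchange j i (exchange i j B)" by (simp only:)
    then show ?thesis by (simp only: inv[OF 3(2,3)] inv[OF 3(4,5)])
  qed
qed

text \<open>Two moved sets trade \<open>j\<close> for \<open>i\<close> together. If only
  \<open>A\<close> moves, the intersection can shrink only when \<open>B\<close> contains
  \<open>j\<close> but not \<open>i\<close>; then \<open>B\<close> stays because its own exchange
  lies in \<open>F\<close>, and \<open>A\<close> meets that exchange in the same set as
  \<open>exchange i j A\<close> meets \<open>B\<close>.\<close>

lemma card_Int_shift:
  assumes F: "intersecting_family t F" and fin: "\<And>A. A \<in> F \<Longrightarrow> finite A"
    and A: "A \<in> F" and B: "B \<in> F"
  shows "t \<le> card (shift F i j A \<inter> shift F i j B)"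
proof -
  have one: "t \<le> card (exchange i j A \<inter> B)"
    if A: "A \<in> F" "j \<in> A" "i \<notin> A" and B: "B \<in> F" "\<not> (j \<in> B \<and> i \<notin> B \<and> exchange i j B \<notin> F)" for A B
  proof -
    have fAB: "finite (A \<inter> B)" "finite B" using fin A B by auto
    consider "j \<notin> B" | "i \<in> B" | "j \<in> B" "i \<notin> B" "exchange i j B \<in> F" using B by blast
    then show ?thesis
    proof cases
      case 1
      then have "A \<inter> B \<subseteq> exchange i j A \<inter> B" by (auto simp: exchange_def)
      then have "card (A \<inter> B) \<le> card (exchange i j A \<inter> B)" using fAB by (intro card_mono) auto
      then show ?thesis using F A B by (meson intersecting_family_def order_trans)
    next
      case 2
      then have "exchange i j A \<inter> B = insert i (A \<inter> B - {j})" by (auto simp: exchange_def)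
      moreover have "i \<notin> A \<inter> B - {j}" using A by blast
      ultimately have "card (exchange i j A \<inter> B) = Suc (card (A \<inter> B - {j}))" using fAB by simp
      then have "card (A \<inter> B) \<le> card (exchange i j A \<inter> B)" using fAB by (simp add: card_Diff_singleton_if) linarith
      then show ?thesis using F A B by (meson intersecting_family_def order_trans)
    next
      case 3
      then have "exchange i j A \<inter> B = A \<inter> exchange i j B" using A by (auto simp: exchange_def)
      then show ?thesis using F A 3 by (simp add: intersecting_family_def)
    qed
  qed
  have both: "t \<le> card (exchange i j A \<inter> exchange i j B)" if "j \<in> A" "i \<notin> A" "j \<in> B" "i \<notin> B"
  proof -
    have "exchange i j A \<inter> exchange i j B = exchange i j (A \<inter> B)" by (auto simp: exchange_def)
    moreover have "card (exchange i j (A \<inter> B)) = card (A \<inter> B)"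
      using that fin[OF A] by (intro card_exchange) auto
    ultimately show ?thesis using F A B by (simp add: intersecting_family_def)
  qed
  show ?thesis
  proof (cases "j \<in> A \<and> i \<notin> A \<and> exchange i j A \<notin> F"; cases "j \<in> B \<and> i \<notin> B \<and> exchange i j B \<notin> F")
    assume "j \<in> A \<and> i \<notin> A \<and> exchange i j A \<notin> F" "j \<in> B \<and> i \<notin> B \<and> exchange i j B \<notin> F"
    then show ?thesis using both by (simp add: shift_def)
  next
    assume h: "j \<in> A \<and> i \<notin> A \<and> exchange i j A \<notin> F" "\<not> (j \<in> B \<and> i \<notin> B \<and> exchange i j B \<notin> F)"
    have "shift F i j A = exchange i j A" using h(1) by (simp only: shift_def if_True simp_thms)
    moreover have "shift F i j B = B" using h(2) by (simp only: shift_def if_False)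
    ultimately show ?thesis using one[OF A _ _ B h(2)] h(1) by simp
  next
    assume h: "\<not> (j \<in> A \<and> i \<notin> A \<and> exchange i j A \<notin> F)" "j \<in> B \<and> i \<notin> B \<and> exchange i j B \<notin> F"
    have "shift F i j B = exchange i j B" using h(2) by (simp only: shift_def if_True simp_thms)
    moreover have "shift F i j A = A" using h(1) by (simp only: shift_def if_False)
    ultimately show ?thesis using one[OF B _ _ A h(1)] h(2) by (simp add: Int_commute)
  next
    assume h: "\<not> (j \<in> A \<and> i \<notin> A \<and> exchange i j A \<notin> F)" "\<not> (j \<in> B \<and> i \<notin> B \<and> exchange i j B \<notin> F)"
    have "shift F i j A = A" using h(1) by (simp only: shift_def if_False)
    moreover have "shift F i j B = B" using h(2) by (simp only: shift_def if_False)
    ultimately show ?thesis using F A B by (simp add: intersecting_family_def)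
  qed
qed

text \<open>A family minimising the total of all elements of its members is fixed by every shift.\<close>

lemma exists_shifted_family:
  assumes "uniform_family n k F" "intersecting_family t F"
  shows "\<exists>F'. card F' = card F \<and> uniform_family n k F' \<and> intersecting_family t F' \<and> shifted F'"
proof -
  let ?P = "\<lambda>H. card H = card F \<and> uniform_family n k H \<and> intersecting_family t H"
  let ?w = "\<lambda>H. \<Sum>A \<in> H. \<Sum>A"
  have "?P F" using assms by simp
  then obtain H where H: "?P H" and min: "\<And>H'. ?P H' \<Longrightarrow> ?w H \<le> ?w H'"
    using ex_has_least_nat[of ?P F ?w] by blast
  have "exchange i j A \<in> H" if A: "A \<in> H" and ij: "1 \<le> i" "i < j" "j \<in> A" "i \<notin> A" for A i j
  proof (rule ccontr)
    assume no: "exchange i j A \<notin> H"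
    have uni: "uniform_family n k H" using H by simp
    note memb = uniform_familyD[OF uni]
    have decr: "\<Sum>(exchange i j B) < \<Sum>B" if "B \<in> H" "j \<in> B" "i \<notin> B" for B
    proof -
      have "\<Sum>(exchange i j B) = i + \<Sum>(B - {j})"
        using that memb(2) by (simp add: exchange_def)
      moreover have "\<Sum>B = j + \<Sum>(B - {j})" using that memb(2) by (simp add: sum.remove)
      ultimately show ?thesis using ij by simp
    qed
    define H' where "H' = shift H i j ` H"
    have "card H' = card F" using H inj_on_shift by (metis H'_def card_image)
    moreover have "uniform_family n k H'"
    proof -
      have "shift H i j B \<subseteq> {1..n} \<and> card (shift H i j B) = k" if B: "B \<in> H" for B
      proof (cases "j \<in> B \<and> i \<notin> B")
        case True
        then have "j \<le> n" using memb(1)[OF B] by auto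
        then have "exchange i j B \<subseteq> {1..n}" using memb(1)[OF B] ij by (auto simp: exchange_def)
        then show ?thesis using True memb[OF B] card_exchange[of B j i] by (simp add: shift_def)
      next
        case False
        then show ?thesis using memb[OF B] by (auto simp: shift_def)
      qed
      then show ?thesis by (auto simp: uniform_family_def H'_def)
    qed
    moreover have "intersecting_family t H'"
      using card_Int_shift[of t H] H memb(2) by (auto simp: intersecting_family_def H'_def)
    ultimately have "?w H \<le> ?w H'" by (intro min) simp
    also have "?w H' = (\<Sum>B \<in> H. \<Sum>(shift H i j B))"
      unfolding H'_def by (simp add: sum.reindex[OF inj_on_shift])
    also have "\<dots> < ?w H"
    proof (rule sum_strict_mono_ex1)
      show "finite H" using uni by (rule uniform_family_finite)
      show "\<forall>B \<in> H. \<Sum>(shift H i j B) \<le> \<Sum>B"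
        using decr by (auto simp: shift_def intro: less_imp_le)
      show "\<exists>B \<in> H. \<Sum>(shift H i j B) < \<Sum>B"
        using A ij no decr[of A] by (auto simp: shift_def intro!: bexI[of _ A])
    qed
    finally show False by simp
  qed
  then show ?thesis using H by (auto simp: shifted_def)
qed

text \<open>The largest elements are exchanged first: domination at \<open>m = Max X\<close> puts
  all of \<open>Y\<close> below \<open>Max X\<close>, so shiftedness applies to the two maxima, and
  domination survives their removal. Prefixes start at 1, so 0 would escape the counts.\<close>

lemma shifted_exchange:
  assumes "shifted F" "A \<in> F" "finite X" "finite Y" "X \<subseteq> A" "Y \<inter> A = {}" "0 \<notin> X" "0 \<notin> Y"
    "card X = card Y" "\<And>m. card (X \<inter> {1..m}) \<le> card (Y \<inter> {1..m})"
  shows "(A - X) \<union> Y \<in> F"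
  using assms
proof (induction "card X" arbitrary: A X Y)
  case 0
  then show ?case by simp
next
  case (Suc c)
  then have ne: "X \<noteq> {}" "Y \<noteq> {}" by auto
  define x y where "x = Max X" and "y = Max Y"
  have x: "x \<in> X" "X \<subseteq> {1..x}" and y: "y \<in> Y" "Y \<subseteq> {1..y}"
    using Suc.prems ne by (auto simp: x_def y_def Suc_le_eq intro: gr0I)
  have "card Y \<le> card (Y \<inter> {1..x})"
    using Suc.prems(9) Suc.prems(10)[of x] x(2) by (simp add: Int_absorb2)
  then have "Y \<inter> {1..x} = Y" using Suc.prems(4) by (intro card_seteq) auto
  then have "y \<le> x" using y by auto
  moreover have "y \<noteq> x" using x y Suc.prems(5,6) by auto
  ultimately have yx: "y < x" by simp
  define A' where "A' = exchange y x A"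
  have "1 \<le> y" "x \<in> A" "y \<notin> A" using x y Suc.prems(5,6) by auto
  then have "A' \<in> F" unfolding A'_def using Suc.prems(1,2) yx by (auto simp: shifted_def)
  have "(A' - (X - {x})) \<union> (Y - {y}) \<in> F"
  proof (rule Suc.hyps(1))
    show "c = card (X - {x})" using Suc.hyps(2) x Suc.prems(3) by simp
    show "card (X - {x}) = card (Y - {y})" using Suc.prems x y by simp
    show "X - {x} \<subseteq> A'" using Suc.prems(5) by (auto simp: A'_def exchange_def)
    show "(Y - {y}) \<inter> A' = {}" using Suc.prems(6) by (auto simp: A'_def exchange_def)
    fix m
    show "card ((X - {x}) \<inter> {1..m}) \<le> card ((Y - {y}) \<inter> {1..m})"
    proof (cases "y \<le> m")
      case True
      then have "(Y - {y}) \<inter> {1..m} = Y - {y}" using y(2) by auto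
      moreover have "card ((X - {x}) \<inter> {1..m}) \<le> card (X - {x})"
        using Suc.prems(3) by (intro card_mono) auto
      ultimately show ?thesis using Suc.prems x y by simp
    next
      case False
      then have "(Y - {y}) \<inter> {1..m} = Y \<inter> {1..m}" by auto
      moreover have "card ((X - {x}) \<inter> {1..m}) \<le> card (X \<inter> {1..m})" by (intro card_mono) auto
      ultimately show ?thesis using Suc.prems(10)[of m] by simp
    qed
  qed (use Suc.prems \<open>A' \<in> F\<close> in auto)
  moreover have "(A' - (X - {x})) \<union> (Y - {y}) = (A - X) \<union> Y"
    using x y Suc.prems(5,6) by (auto simp: A'_def exchange_def)
  ultimately show ?case by simp
qed

text \<open>Discrete intermediate value argument: lengthening the prefix by one raises the count by
  at most one.\<close>

lemma exists_prefix_card: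
  fixes S :: "nat set"
  assumes "r \<le> card (S \<inter> {1..m})"
  shows "\<exists>p \<le> m. card (S \<inter> {1..p}) = r"
  using assms
proof (induction m)
  case (Suc m)
  show ?case
  proof (cases "r \<le> card (S \<inter> {1..m})")
    case True
    then show ?thesis using Suc.IH le_SucI by blast
  next
    case False
    have "S \<inter> {1..Suc m} \<subseteq> insert (Suc m) (S \<inter> {1..m})" by (auto simp: le_Suc_eq)
    then have "card (S \<inter> {1..Suc m}) \<le> card (insert (Suc m) (S \<inter> {1..m}))" by (intro card_mono) auto
    also have "\<dots> \<le> Suc (card (S \<inter> {1..m}))" by (rule card_insert_le_m1) auto
    finally show ?thesis using False Suc.prems by (intro exI[of _ "Suc m"]) simp
  qed
qed auto

text \<open>Otherwise the elements of \<open>A\<close> from the \<open>t\<close>-th on can all be exchanged for smaller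
  elements outside \<open>A\<close>, leaving a member that shares only \<open>t - 1\<close> elements with \<open>A\<close>.\<close>

lemma shifted_intersecting_prefix:
  assumes F: "shifted F" "uniform_family n k F" "intersecting_family t F"
    and t: "1 \<le> t" "t \<le> k" and A: "A \<in> F"
  shows "\<exists>i \<le> k - t. t + i \<le> card (A \<inter> {1..t + 2 * i})"
proof (rule ccontr)
  assume neg: "\<not> ?thesis"
  note memb = uniform_familyD[OF F(2) A]
  have Ann: "A \<inter> {1..n} = A" using memb by auto
  define c where "c m = card (A \<inter> {1..m})" for m
  have small: "c (t + 2 * i) < t + i" if "i \<le> k - t" for i using neg that by (force simp: c_def)
  have c_le: "c m \<le> m" for m unfolding c_def using card_mono[of "{1..m}" "A \<inter> {1..m}"] by simp
  have c_k: "c m \<le> k" for m unfolding c_def using card_mono[of A "A \<inter> {1..m}"] memb by simp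
  have c_Suc: "c (Suc m) \<le> Suc (c m)" for m
  proof -
    have "c (Suc m) \<le> card (insert (Suc m) (A \<inter> {1..m}))"
      unfolding c_def by (intro card_mono) (auto simp: le_Suc_eq)
    also have "\<dots> \<le> Suc (c m)" unfolding c_def by (rule card_insert_le_m1) auto
    finally show ?thesis .
  qed
  have c_compl: "card (- A \<inter> {1..m}) = m - c m" for m
  proof -
    have "- A \<inter> {1..m} = {1..m} - (A \<inter> {1..m})" by auto
    then show ?thesis by (simp add: c_def card_Diff_subset)
  qed
  \<comment> \<open>The negated claim bounds \<open>c\<close> only at \<open>m = t + 2 * i\<close>.
    An odd offset costs at most one more element, short prefixes are covered by
    \<open>c m \<le> m\<close>, and long ones by \<open>c m \<le> k\<close>.\<close>
  have half: "2 * c m + 1 \<le> m + t" for m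
  proof -
    consider "m < t" | "t \<le> m" "m \<le> t + 2 * (k - t) + 1" | "t + 2 * (k - t) + 1 < m" by linarith
    then show ?thesis
    proof cases
      case 1
      then show ?thesis using c_le[of m] by linarith
    next
      case 2
      define i where "i = (m - t) div 2"
      have i: "i \<le> k - t" and m: "m = t + 2 * i \<or> m = Suc (t + 2 * i)" using 2 by (auto simp: i_def)
      show ?thesis using m small[OF i] c_Suc[of "t + 2 * i"] by auto
    next
      case 3
      then show ?thesis using c_k[of m] t by linarith
    qed
  qed
  have "t - 1 \<le> card (A \<inter> {1..n})" using Ann memb t by simp
  then obtain p where p: "card (A \<inter> {1..p}) = t - 1" using exists_prefix_card by blast
  have "k - t + 1 \<le> card (- A \<inter> {1..t + 2 * (k - t)})"
    unfolding c_compl using small[of "k - t"] t by simp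
  then obtain q where q: "card (- A \<inter> {1..q}) = k - t + 1" using exists_prefix_card by blast
  \<comment> \<open>\<open>X\<close> holds the elements of \<open>A\<close> from the
    \<open>t\<close>-th on, \<open>Y\<close> equally many of the smallest positive non-elements;
    \<open>half\<close> is what makes \<open>Y\<close> dominate \<open>X\<close> on every
    prefix.\<close>
  define X Y where "X = A - {1..p}" and "Y = - A \<inter> {1..q}"
  have cardX: "card X = k - t + 1"
  proof -
    have "X = A - (A \<inter> {1..p})" by (auto simp: X_def)
    then show ?thesis using p t memb by (simp add: card_Diff_subset)
  qed
  have dom: "card (X \<inter> {1..m}) \<le> card (Y \<inter> {1..m})" for m
  proof (cases "m \<le> q")
    case True
    then have "Y \<inter> {1..m} = - A \<inter> {1..m}" by (auto simp: Y_def)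
    then have Y: "card (Y \<inter> {1..m}) = m - c m" using c_compl[of m] by simp
    show ?thesis
    proof (cases "p \<le> m")
      case True
      then have "X \<inter> {1..m} = (A \<inter> {1..m}) - (A \<inter> {1..p})" by (auto simp: X_def)
      moreover have "A \<inter> {1..p} \<subseteq> A \<inter> {1..m}" using True by auto
      ultimately have "card (X \<inter> {1..m}) = c m - (t - 1)" using p by (simp add: card_Diff_subset c_def)
      then show ?thesis using Y half[of m] t by linarith
    next
      case False
      then have "X \<inter> {1..m} = {}" by (auto simp: X_def)
      then show ?thesis by simp
    qed
  next
    case False
    then have "Y \<inter> {1..m} = Y" by (auto simp: Y_def)
    moreover have "card (X \<inter> {1..m}) \<le> card X" using memb by (intro card_mono) (auto simp: X_def)
    ultimately show ?thesis using q cardX by (simp add: Y_def)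
  qed
  have "(A - X) \<union> Y \<in> F"
  proof (rule shifted_exchange[OF F(1) A])
    show "card X = card Y" using cardX q by (simp add: Y_def)
    show "card (X \<inter> {1..m}) \<le> card (Y \<inter> {1..m})" for m by (rule dom)
    show "0 \<notin> X" using memb(1) by (auto simp: X_def)
  qed (use memb in \<open>auto simp: X_def Y_def\<close>)
  then have "t \<le> card (A \<inter> ((A - X) \<union> Y))" using F(3) A by (simp add: intersecting_family_def)
  also have "A \<inter> ((A - X) \<union> Y) = A \<inter> {1..p}" by (auto simp: X_def Y_def)
  finally show False using p t by simp
qed

section \<open>Counting sets with prescribed elements\<close>

lemma card_subsets_between:
  assumes "S \<subseteq> {1..n::nat}" "D \<subseteq> {1..n}" "S \<inter> D = {}" "card S \<le> k"
  shows "card {A. A \<subseteq> {1..n} \<and> card A = k \<and> S \<subseteq> A \<and> A \<inter> D = {}}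
    = (n - card S - card D) choose (k - card S)"
proof -
  let ?U = "{1..n} - S - D"
  have fin: "finite S" "finite D" using assms finite_subset by blast+
  have "card ?U = n - card S - card D"
  proof -
    have "?U = {1..n} - (S \<union> D)" by auto
    then show ?thesis using assms fin by (simp add: card_Diff_subset card_Un_disjoint)
  qed
  then have "card {B. B \<subseteq> ?U \<and> card B = k - card S} = (n - card S - card D) choose (k - card S)"
    using n_subsets[of ?U] by simp
  moreover have bij: "bij_betw (\<lambda>B. S \<union> B) {B. B \<subseteq> ?U \<and> card B = k - card S}
      {A. A \<subseteq> {1..n} \<and> card A = k \<and> S \<subseteq> A \<and> A \<inter> D = {}}"
  proof (rule bij_betw_byWitness[where f' = "\<lambda>A. A - S"])
    show "(\<lambda>B. S \<union> B) ` {B. B \<subseteq> ?U \<and> card B = k - card S}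
        \<subseteq> {A. A \<subseteq> {1..n} \<and> card A = k \<and> S \<subseteq> A \<and> A \<inter> D = {}}"
    proof clarify
      fix B assume B: "B \<subseteq> ?U" "card B = k - card S"
      have "card (S \<union> B) = card S + card B"
        using B fin finite_subset[of B ?U] by (intro card_Un_disjoint) auto
      then show "S \<union> B \<subseteq> {1..n} \<and> card (S \<union> B) = k \<and> S \<subseteq> S \<union> B \<and> (S \<union> B) \<inter> D = {}"
        using B assms by auto
    qed
    show "(\<lambda>A. A - S) ` {A. A \<subseteq> {1..n} \<and> card A = k \<and> S \<subseteq> A \<and> A \<inter> D = {}}
        \<subseteq> {B. B \<subseteq> ?U \<and> card B = k - card S}"
      using fin by (auto simp: card_Diff_subset)
  qed auto
  ultimately show ?thesis using bij_betw_same_card[OF bij] by simp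
qed

lemma card_supersets:
  assumes "S \<subseteq> {1..n::nat}" "card S \<le> k"
  shows "card {A. A \<subseteq> {1..n} \<and> card A = k \<and> S \<subseteq> A} = (n - card S) choose (k - card S)"
  using card_subsets_between[of S n "{}" k] assms by simp

text \<open>Union bound over the \<open>r\<close>-subsets of the prefix that \<open>A\<close> may
  contain.\<close>

lemma card_large_prefix_le:
  assumes "m \<le> n" "r \<le> k"
  shows "card {A. A \<subseteq> {1..n} \<and> card A = k \<and> r \<le> card (A \<inter> {1..m})}
    \<le> (m choose r) * ((n - r) choose (k - r))"
proof -
  let ?R = "{R. R \<subseteq> {1..m} \<and> card R = r}"
  let ?C = "\<lambda>R. {A. A \<subseteq> {1..n} \<and> card A = k \<and> R \<subseteq> A}"
  have finR: "finite ?R" by (simp add: finite_subsets_card)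
  have "{A. A \<subseteq> {1..n} \<and> card A = k \<and> r \<le> card (A \<inter> {1..m})} \<subseteq> (\<Union>R \<in> ?R. ?C R)"
  proof clarify
    fix A assume A: "A \<subseteq> {1..n}" "r \<le> card (A \<inter> {1..m})"
    then obtain R where "R \<subseteq> A \<inter> {1..m}" "card R = r" by (meson obtain_subset_with_card_n)
    then show "A \<in> (\<Union>R \<in> ?R. {B. B \<subseteq> {1..n} \<and> card B = card A \<and> R \<subseteq> B})" using A by blast
  qed
  then have "card {A. A \<subseteq> {1..n} \<and> card A = k \<and> r \<le> card (A \<inter> {1..m})} \<le> card (\<Union>R \<in> ?R. ?C R)"
    using finR by (intro card_mono) (auto intro: finite_subsets_card)
  also have "\<dots> \<le> (\<Sum>R \<in> ?R. card (?C R))" using finR by (rule card_UN_le)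
  also have "\<dots> = (\<Sum>R \<in> ?R. (n - r) choose (k - r))"
  proof (rule sum.cong)
    fix R assume "R \<in> ?R"
    then show "card (?C R) = (n - r) choose (k - r)"
      using assms card_supersets[of R n k] by fastforce
  qed simp
  also have "\<dots> = (m choose r) * ((n - r) choose (k - r))" using n_subsets[of "{1..m}" r] by simp
  finally show ?thesis .
qed

section \<open>Numerical estimates for members outside the star\<close>

lemma choose_le_choose_diff:
  assumes "b \<le> n"
  shows "n choose Suc k \<le> ((n - b) choose Suc k) + b * ((n - 1) choose k)"
  using assms
proof (induction b)
  case (Suc b)
  have "n - b = Suc (n - Suc b)" using Suc.prems by simp
  then have "(n - b) choose Suc k = ((n - Suc b) choose k) + ((n - Suc b) choose Suc k)" by simp
  moreover have "(n - Suc b) choose k \<le> (n - 1) choose k" by (intro binomial_right_mono) simp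
  ultimately show ?case using Suc by simp
qed simp

text \<open>By absorption, the ratio of the binomials in \<open>t + 2 * i\<close> is
  \<open>(t + 2 * i + 2) * (t + 2 * i + 1) / ((i + 1) * (t + i + 1))\<close>, which is at most
  \<open>t + 3\<close>; that of the other two is \<open>(s - i) / (n - t - i)\<close>, at most
  \<open>1 / (2 * (t + 3))\<close>.\<close>

lemma prefix_count_halves:
  fixes n s t i :: nat
  assumes i: "1 \<le> i" "i < s" and t: "1 \<le> t"
    and n: "2 * (t + 3) * (s - 1) + t + 1 \<le> n"
  shows "2 * (((t + 2 * Suc i) choose (Suc i)) * ((n - t - Suc i) choose (s - Suc i)))
    \<le> ((t + 2 * i) choose i) * ((n - t - i) choose (s - i))"
proof -
  define c c' e e' where "c = (t + 2 * i) choose i" and "c' = (t + 2 * Suc i) choose (Suc i)"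
    and "e = (n - t - i) choose (s - i)" and "e' = (n - t - Suc i) choose (s - Suc i)"
  define q where "q = (t + 2 * i + 1) choose i"
  have "c' * (i + 1) = (t + 2 * i + 2) * q"
    using times_binomial_minus1_eq[of "Suc i" "t + 2 * Suc i"]
    by (simp add: c'_def q_def mult.commute)
  then have "c' * ((i + 1) * (t + i + 1)) = (t + 2 * i + 2) * ((t + i + 1) * q)"
    by (metis mult.assoc mult.commute)
  moreover have "(t + i + 1) * q = (t + 2 * i + 1) * c"
    using binomial_absorb_comp[of "t + 2 * i + 1" i] by (simp add: c_def q_def Suc_diff_le add.commute)
  ultimately have c': "c' * ((i + 1) * (t + i + 1)) = (t + 2 * i + 2) * ((t + 2 * i + 1) * c)"
    by (simp only:)
  have pos: "s - i > 0" using i by simp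
  have "i \<le> s - 1" using i by simp
  have n': "2 * ((t + 3) * (s - i)) \<le> n - t - i"
  proof -
    have "2 * ((t + 3) * (s - i)) + i \<le> 2 * ((t + 3) * (s - 1)) + 1"
    proof -
      obtain w where w: "i = Suc w" using i by (cases i) auto
      have "w \<le> (t + 3) * w" by simp
      moreover have "s - 1 = (s - i) + w" using i w by simp
      ultimately show ?thesis using w by (simp add: distrib_left)
    qed
    then show ?thesis using n by (simp add: algebra_simps)
  qed
  have e': "e' * (n - t - i) = (s - i) * e"
    using times_binomial_minus1_eq[OF pos, of "n - t - i"] i by (simp add: e_def e'_def)
  \<comment> \<open>The right side exceeds the left by \<open>(t - 1) * (i - 1)\<close>.\<close>
  have "2 * (t + 2 * i + 1) \<le> (t + 3) * (i + 1)"
  proof -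
    obtain w where "i = Suc w" using i by (cases i) auto
    moreover obtain v where "t = Suc v" using t by (cases t) auto
    ultimately show ?thesis by (simp add: algebra_simps)
  qed
  then have "2 * (2 * (t + 2 * i + 1)) * (s - i) \<le> 2 * ((t + 3) * (i + 1)) * (s - i)"
    by (intro mult_right_mono) simp_all
  also have "\<dots> = (i + 1) * (2 * ((t + 3) * (s - i)))" by (simp only: ac_simps)
  also have "\<dots> \<le> (i + 1) * (n - t - i)" using n' by (rule mult_left_mono) simp
  finally have key: "2 * (2 * (t + 2 * i + 1)) * (s - i) \<le> (i + 1) * (n - t - i)" .
  have "(2 * (c' * e')) * ((i + 1) * (t + i + 1) * (n - t - i))
      = 2 * (c' * ((i + 1) * (t + i + 1))) * (e' * (n - t - i))" by (simp only: ac_simps)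
  also have "\<dots> = 2 * ((t + 2 * i + 2) * ((t + 2 * i + 1) * c)) * ((s - i) * e)" by (simp only: c' e')
  also have "\<dots> \<le> 2 * ((2 * (t + i + 1)) * ((t + 2 * i + 1) * c)) * ((s - i) * e)"
    by (intro mult_right_mono mult_left_mono) simp_all
  also have "\<dots> = (2 * (2 * (t + 2 * i + 1)) * (s - i)) * ((t + i + 1) * c * e)" by (simp only: ac_simps)
  also have "\<dots> \<le> ((i + 1) * (n - t - i)) * ((t + i + 1) * c * e)"
    using key by (rule mult_right_mono) simp
  also have "\<dots> = (c * e) * ((i + 1) * (t + i + 1) * (n - t - i))" by (simp only: ac_simps)
  finally have "(2 * (c' * e')) * ((i + 1) * (t + i + 1) * (n - t - i))
      \<le> (c * e) * ((i + 1) * (t + i + 1) * (n - t - i))" .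
  moreover have "(i + 1) * (t + i + 1) * (n - t - i) > 0"
  proof -
    have "2 * ((t + 3) * (s - i)) > 0" using pos by simp
    then have "n - t - i > 0" using n' by linarith
    then show ?thesis by simp
  qed
  ultimately have "2 * (c' * e') \<le> c * e" by (metis mult_le_cancel2)
  then show ?thesis by (simp only: c_def c'_def e_def e'_def)
qed

text \<open>The lower bounds on \<open>n\<close> required below: for the final comparison in the
  count, for the halving of its terms, and for the prefixes \<open>{1..t + 2 * i}\<close> to fit
  into \<open>{1..n}\<close>.\<close>

lemma quadratic_thresholds:
  fixes n s t :: nat
  assumes "1 \<le> s" "1 \<le> t" and n: "3 * (s + t)\<^sup>2 + (s + t) + 2 \<le> 2 * n"
  shows "s * (3 * t + 4) + 2 * s * (s + 1) + 2 * t \<le> 2 * n"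
    and "2 * (t + 3) * (s - 1) + t + 1 \<le> n"
    and "s + t + s \<le> n"
proof -
  obtain a where a: "s = Suc a" using assms by (cases s) auto
  obtain b where b: "t = Suc b" using assms by (cases t) auto
  have sq: "3 * a \<le> a * a + 3"
  proof (cases "a < 3")
    case True
    then have "a = 0 \<or> a = 1 \<or> a = 2" by auto
    then show ?thesis by auto
  qed (simp add: mult_le_mono1 trans_le_add1)
  have n': "3 * (a * a) + 6 * (a * b) + 3 * (b * b) + 13 * a + 13 * b + 16 \<le> 2 * n"
    using n unfolding a b power2_eq_square by (simp add: algebra_simps)
  show "s * (3 * t + 4) + 2 * s * (s + 1) + 2 * t \<le> 2 * n"
    using n' unfolding a b by (simp add: algebra_simps)
  have "2 * (2 * (t + 3) * (s - 1) + t + 1) \<le> 2 * n"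
    using n' sq unfolding a b by (simp add: algebra_simps)
  then show "2 * (t + 3) * (s - 1) + t + 1 \<le> n" by simp
  show "s + t + s \<le> n" using n' unfolding a b by (simp add: algebra_simps)
qed

text \<open>Everything is measured in \<open>L\<close>: the left side is at most
  \<open>(t + (t + 4) / 2) * L\<close>, the right side at least
  \<open>((n - t) / s - (s + 1)) * L\<close>, and the first threshold compares the two
  factors.\<close>

lemma nonstar_count_le:
  fixes n s t :: nat
  assumes s: "1 \<le> s" and t: "1 \<le> t" and n: "3 * (s + t)\<^sup>2 + (s + t) + 2 \<le> 2 * n"
  shows "t * ((n - t - 1) choose (s - 1))
      + (\<Sum>i = 2..s. ((t + 2 * i) choose i) * ((n - t - i) choose (s - i)))
    \<le> (n - t - s - 1) choose s"
proof -
  note th = quadratic_thresholds[OF s t n]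
  define L where "L = (n - t - 1) choose (s - 1)"
  define u where "u i = ((t + 2 * i) choose i) * ((n - t - i) choose (s - i))" for i
  have halves: "2 * u (Suc i) \<le> u i" if "1 \<le> i" "i < s" for i
    unfolding u_def by (rule prefix_count_halves) (use that t th in auto)
  have sum: "2 * (\<Sum>i = 2..s. u i) \<le> (t + 4) * L"
  proof (cases "s = 1")
    case False
    then have s2: "2 \<le> s" using s by simp
    \<comment> \<open>A geometric series; the extra \<open>u j\<close> stands for the tail and lets
      the induction close.\<close>
    have "(\<Sum>i = 2..j. u i) + u j \<le> 2 * u 2" if "2 \<le> j" "j \<le> s" for j
      using that
    proof (induction rule: dec_induct)
      case (step j)
      then have "2 * u (Suc j) \<le> u j" using halves[of j] by simp
      with step show ?case by simp
    qed simp
    from this[of s] have "(\<Sum>i = 2..s. u i) \<le> 2 * u 2" using s2 by simp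
    \<comment> \<open>\<open>u 2\<close> is estimated directly, as halving
      \<open>u 1 = (t + 2) * L\<close> would give only the weaker
      \<open>(t + 2) * L / 2\<close>.\<close>
    moreover have "4 * u 2 \<le> (t + 4) * L"
    proof -
      have two: "2 * ((t + 4) choose 2) = (t + 4) * (t + 3)"
        using times_binomial_minus1_eq[of 2 "t + 4"] by simp
      have absorb: "(n - t - 1) * ((n - t - 2) choose (s - 2)) = (s - 1) * L"
        using times_binomial_minus1_eq[of "s - 1" "n - t - 1"] s2
        by (simp add: L_def numeral_2_eq_2)
      have pos: "n - t - 1 > 0" using th(3) s2 by linarith
      have "4 * u 2 * (n - t - 1) = 2 * (2 * ((t + 4) choose 2)) * ((n - t - 1) * ((n - t - 2) choose (s - 2)))"
        by (simp add: u_def algebra_simps)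
      also have "\<dots> = 2 * ((t + 4) * (t + 3)) * ((s - 1) * L)" by (simp only: two absorb)
      also have "\<dots> = (t + 4) * L * (2 * (t + 3) * (s - 1))" by (simp only: ac_simps)
      also have "\<dots> \<le> (t + 4) * L * (n - t - 1)" using th(2) by (intro mult_left_mono) simp_all
      finally show ?thesis using pos by (metis mult_le_cancel2)
    qed
    ultimately show ?thesis by simp
  qed simp
  have star: "(n - t) choose s \<le> ((n - t - s - 1) choose s) + (s + 1) * L"
    using choose_le_choose_diff[of "s + 1" "n - t" "s - 1"] th(3) s t by (simp add: L_def)
  have absorb: "s * ((n - t) choose s) = (n - t) * L"
    using times_binomial_minus1_eq[of s "n - t"] s by (simp add: L_def)
  have "2 * s * (t * L + (\<Sum>i = 2..s. u i)) = 2 * s * t * L + s * (2 * (\<Sum>i = 2..s. u i))"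
    by (simp add: algebra_simps)
  also have "\<dots> \<le> 2 * s * t * L + s * ((t + 4) * L)" using sum by (intro add_left_mono mult_left_mono) simp_all
  also have "\<dots> = (s * (3 * t + 4)) * L" by (simp add: algebra_simps)
  finally have "2 * s * (t * L + (\<Sum>i = 2..s. u i)) + 2 * s * (s + 1) * L
      \<le> (s * (3 * t + 4) + 2 * s * (s + 1)) * L" by (simp add: distrib_right)
  also have "\<dots> \<le> (2 * (n - t)) * L" using th(1) by (intro mult_right_mono) simp_all
  also have "\<dots> = 2 * (s * ((n - t) choose s))" by (simp add: absorb)
  also have "\<dots> \<le> 2 * (s * (((n - t - s - 1) choose s) + (s + 1) * L))"
    using star by simp
  also have "\<dots> = 2 * s * ((n - t - s - 1) choose s) + 2 * s * (s + 1) * L"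
    by (simp add: algebra_simps)
  finally have "2 * s * (t * L + (\<Sum>i = 2..s. u i)) \<le> 2 * s * ((n - t - s - 1) choose s)" by simp
  then show ?thesis using s by (simp add: L_def u_def)
qed

text \<open>Such a member excludes \<open>(n - k - 1) choose (k - t)\<close> sets from the star of \<open>{1..t}\<close>.\<close>

lemma exists_near_star_member:
  assumes F: "shifted F" "uniform_family n k F" and t: "t \<le> k"
    and A: "A \<in> F" "\<not> {1..t} \<subseteq> A"
  shows "\<exists>G \<in> F. card (G \<inter> {1..t}) = t - 1"
proof -
  let ?F1 = "{A \<in> F. \<not> {1..t} \<subseteq> A}"
  have "finite ?F1" using uniform_family_finite[OF F(2)] by simp
  moreover have "?F1 \<noteq> {}" using A by blast
  \<comment> \<open>\<open>G\<close> has the largest trace on \<open>{1..t}\<close> among the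
    members outside the star. If it missed two elements of \<open>{1..t}\<close>, exchanging some
    \<open>j > t\<close> of \<open>G\<close> for one of them would enlarge the trace and still stay
    outside the star.\<close>
  ultimately obtain G where G: "G \<in> ?F1"
    and "(MAX A \<in> ?F1. card (A \<inter> {1..t})) = card (G \<inter> {1..t})"
    by (rule obtains_MAX)
  then have max: "card (H \<inter> {1..t}) \<le> card (G \<inter> {1..t})" if "H \<in> ?F1" for H
    using \<open>finite ?F1\<close> that Max_ge[of "(\<lambda>A. card (A \<inter> {1..t})) ` ?F1"] by simp
  note memb = uniform_familyD[OF F(2), of G]
  have "G \<inter> {1..t} \<subset> {1..t}" using G by blast
  then have less: "card (G \<inter> {1..t}) < t" using psubset_card_mono[of "{1..t}"] by simp
  have "\<not> card (G \<inter> {1..t}) < t - 1"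
  proof
    assume "card (G \<inter> {1..t}) < t - 1"
    moreover have "card ({1..t} - G) = t - card (G \<inter> {1..t})"
      by (simp add: card_Diff_subset_Int Int_commute)
    ultimately have "card ({1..t} - G) > 1" by linarith
    then obtain i i' where i: "i \<in> {1..t} - G" "i' \<in> {1..t} - G" "i \<noteq> i'"
      by (metis card_eq_0_iff card_le_Suc0_iff_eq finite_Diff finite_atLeastAtMost less_le_not_le One_nat_def)
    have "\<not> G \<subseteq> {1..t}" using less memb G t by (metis (no_types, lifting) Int_absorb2 linorder_not_less mem_Collect_eq)
    then obtain j where j: "j \<in> G" "j \<notin> {1..t}" by blast
    have ij: "1 \<le> i" "i < j" using i j memb G by auto
    then have "exchange i j G \<in> F" using F(1) G i j by (auto simp: shifted_def)
    moreover have "i' \<notin> exchange i j G" using i by (auto simp: exchange_def)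
    ultimately have "card (exchange i j G \<inter> {1..t}) \<le> card (G \<inter> {1..t})" using i by (intro max) blast
    moreover have "exchange i j G \<inter> {1..t} = insert i (G \<inter> {1..t})"
      using i j by (auto simp: exchange_def)
    ultimately show False using i by simp
  qed
  then show ?thesis using less G by (intro bexI[of _ G]) auto
qed

text \<open>After shifting, a family not inside the star of \<open>{1..t}\<close> has a member
  \<open>G\<close> missing exactly one element of \<open>{1..t}\<close>. The star sets that
  \<open>G\<close> excludes are at least as many as all members outside the star.\<close>

theorem erdos_ko_rado_quadratic:
  assumes t: "1 \<le> t" "t \<le> k" and n: "3 * k\<^sup>2 + k + 2 \<le> 2 * n"
    and E: "uniform_family n k E" "intersecting_family t E"
  shows "card E \<le> (n - t) choose (k - t)"
proof -
  obtain F where card: "card F = card E" and F: "shifted F" "uniform_family n k F" "intersecting_family t F"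
    using exists_shifted_family[OF E] by blast
  note memb = uniform_familyD[OF F(2)]
  have finF: "finite F" using F(2) by (rule uniform_family_finite)
  define s where "s = k - t"
  have k: "k = s + t" using t by (simp add: s_def)
  have kn: "k \<le> n"
  proof -
    have "k \<le> k\<^sup>2" by (simp add: power2_eq_square)
    then show ?thesis using n by linarith
  qed
  let ?star = "{A. A \<subseteq> {1..n} \<and> card A = k \<and> {1..t} \<subseteq> A}"
  have finstar: "finite ?star" by (rule finite_subsets_card) simp
  have card_star: "card ?star = (n - t) choose s"
    using card_supersets[of "{1..t}" n k] t kn by (simp add: s_def)
  define F1 where "F1 = {A \<in> F. \<not> {1..t} \<subseteq> A}"
  show ?thesis
  proof (cases "F1 = {}")
    case True
    then have "F \<subseteq> ?star" using memb by (auto simp: F1_def)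
    then have "card F \<le> card ?star" using finstar by (rule card_mono[rotated])
    then show ?thesis using card card_star by (simp add: s_def)
  next
    case False
    then obtain A where A: "A \<in> F" "\<not> {1..t} \<subseteq> A" by (auto simp: F1_def)
    obtain G where G: "G \<in> F" "card (G \<inter> {1..t}) = t - 1"
      using exists_near_star_member[OF F(1,2) t(2) A] by blast
    let ?D = "G - {1..t}"
    \<comment> \<open>Star sets avoiding \<open>?D\<close> meet \<open>G\<close> in only
      \<open>t - 1\<close> elements and so are not members; \<open>?D\<close> has
      \<open>k - (t - 1) = s + 1\<close> elements.\<close>
    let ?missing = "{A. A \<subseteq> {1..n} \<and> card A = k \<and> {1..t} \<subseteq> A \<and> A \<inter> ?D = {}}"
    have prefix: "\<exists>i. 1 \<le> i \<and> i \<le> s \<and> t + i \<le> card (B \<inter> {1..t + 2 * i})" if B: "B \<in> F1" for B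
    proof -
      obtain i where i: "i \<le> s" "t + i \<le> card (B \<inter> {1..t + 2 * i})"
        using shifted_intersecting_prefix[OF F t] B unfolding s_def F1_def by blast
      have "i \<noteq> 0"
      proof
        assume "i = 0"
        then have "card {1..t} \<le> card (B \<inter> {1..t})" using i by simp
        then have "B \<inter> {1..t} = {1..t}" by (intro card_seteq) auto
        then show False using B by (auto simp: F1_def)
      qed
      then show ?thesis using i by (intro exI[of _ i]) simp
    qed
    have s: "1 \<le> s" using prefix[of A] A by (auto simp: F1_def)
    have n': "3 * (s + t)\<^sup>2 + (s + t) + 2 \<le> 2 * n" using n by (simp only: k)
    note th = quadratic_thresholds[OF s t(1) n']
    have "card ?D = s + 1"
    proof -
      have "card ?D = card G - card (G \<inter> {1..t})" using memb(2)[OF G(1)] by (simp add: card_Diff_subset_Int)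
      then show ?thesis using memb(3)[OF G(1)] G(2) t by (simp add: k)
    qed
    then have card_missing: "card ?missing = (n - t - s - 1) choose s"
      using card_subsets_between[of "{1..t}" n ?D k] memb(1)[OF G(1)] t kn by (auto simp: s_def)
    have disj: "(F - F1) \<inter> ?missing = {}"
    proof -
      have "False" if B: "B \<in> F" "{1..t} \<subseteq> B" "B \<inter> ?D = {}" for B
      proof -
        have "B \<inter> G = G \<inter> {1..t}" using B(2,3) by auto
        then have "card (B \<inter> G) = t - 1" using G(2) by simp
        moreover have "t \<le> card (B \<inter> G)" using F(3) B(1) G(1) by (simp add: intersecting_family_def)
        ultimately show False using t by simp
      qed
      then show ?thesis by (auto simp: F1_def)
    qed
    have sub: "F - F1 \<subseteq> ?star" using memb by (auto simp: F1_def)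
    have "card (F - F1) + card ?missing = card ((F - F1) \<union> ?missing)"
      using disj finF finite_subset[OF _ finstar, of ?missing] by (intro card_Un_disjoint[symmetric]) auto
    also have "\<dots> \<le> card ?star" using sub finstar by (intro card_mono) auto
    finally have F0: "card (F - F1) + ((n - t - s - 1) choose s) \<le> (n - t) choose s"
      by (simp only: card_missing card_star)
    \<comment> \<open>The case \<open>i = 1\<close> is treated apart: a set outside the star misses
      some \<open>a \<le> t\<close>, so it contains the rest of \<open>{1..t + 2}\<close>. This
      gives \<open>t\<close> classes instead of the \<open>t + 2\<close> of the plain union
      bound.\<close>
    let ?N = "\<lambda>a. {A. A \<subseteq> {1..n} \<and> card A = k \<and> {1..t + 2} - {a} \<subseteq> A}"
    let ?M = "\<lambda>i. {A. A \<subseteq> {1..n} \<and> card A = k \<and> t + i \<le> card (A \<inter> {1..t + 2 * i})}"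
    have cover: "F1 \<subseteq> (\<Union>a \<in> {1..t}. ?N a) \<union> (\<Union>i \<in> {2..s}. ?M i)"
    proof
      fix B assume B: "B \<in> F1"
      then have BF: "B \<subseteq> {1..n} \<and> card B = k" using memb by (auto simp: F1_def)
      obtain i where i: "1 \<le> i" "i \<le> s" "t + i \<le> card (B \<inter> {1..t + 2 * i})" using prefix[OF B] by blast
      show "B \<in> (\<Union>a \<in> {1..t}. ?N a) \<union> (\<Union>i \<in> {2..s}. ?M i)"
      proof (cases "i = 1")
        case True
        obtain a where a: "a \<in> {1..t}" "a \<notin> B" using B unfolding F1_def by blast
        have "card ({1..t + 2} - {a}) \<le> card (B \<inter> {1..t + 2})" using i a True by simp
        moreover have "B \<inter> {1..t + 2} \<subseteq> {1..t + 2} - {a}" using a by auto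
        ultimately have "B \<inter> {1..t + 2} = {1..t + 2} - {a}" by (intro card_seteq) auto
        then have "B \<in> ?N a" using BF by auto
        then show ?thesis using a by blast
      next
        case False
        then have "i \<in> {2..s}" using i by simp
        moreover have "B \<in> ?M i" using BF i by simp
        ultimately show ?thesis by blast
      qed
    qed
    have fin: "finite (?N a)" "finite (?M i)" for a i by (rule finite_subsets_card; simp)+
    have cardN: "card (?N a) = (n - t - 1) choose (s - 1)" if "a \<in> {1..t}" for a
    proof -
      have "card ({1..t + 2} - {a}) = t + 1" using that by simp
      moreover have "{1..t + 2} - {a} \<subseteq> {1..n}" using th(3) s by auto
      ultimately show ?thesis using card_supersets[of "{1..t + 2} - {a}" n k] s by (simp add: k)
    qed
    have cardM: "card (?M i) \<le> ((t + 2 * i) choose i) * ((n - t - i) choose (s - i))" if "i \<in> {2..s}" for i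
    proof -
      have "card (?M i) \<le> ((t + 2 * i) choose (t + i)) * ((n - (t + i)) choose (k - (t + i)))"
        using that th(3) by (intro card_large_prefix_le) (auto simp: k)
      moreover have "(t + 2 * i) choose (t + i) = (t + 2 * i) choose i"
        using binomial_symmetric[of i "t + 2 * i"] by (simp add: add.commute)
      ultimately show ?thesis by (simp add: k)
    qed
    have "card F1 \<le> card ((\<Union>a \<in> {1..t}. ?N a) \<union> (\<Union>i \<in> {2..s}. ?M i))"
      using cover fin by (intro card_mono) auto
    also have "\<dots> \<le> card (\<Union>a \<in> {1..t}. ?N a) + card (\<Union>i \<in> {2..s}. ?M i)" by (rule card_Un_le)
    also have "\<dots> \<le> (\<Sum>a \<in> {1..t}. card (?N a)) + (\<Sum>i = 2..s. card (?M i))"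
      by (intro add_mono card_UN_le) simp_all
    also have "\<dots> \<le> t * ((n - t - 1) choose (s - 1))
        + (\<Sum>i = 2..s. ((t + 2 * i) choose i) * ((n - t - i) choose (s - i)))"
      using cardN cardM by (intro add_mono sum_mono) simp_all
    also have "\<dots> \<le> (n - t - s - 1) choose s" by (rule nonstar_count_le[OF s t(1) n'])
    finally have "card (F - F1) + card F1 \<le> (n - t) choose s" using F0 by linarith
    moreover have "card F = card (F - F1) + card F1"
      using finF by (simp add: F1_def card_Diff_subset card_mono)
    ultimately show ?thesis using card by (simp add: s_def)
  qed
qed

subsection \<open>The degree of the Kneser graph\<close>

text \<open>Passing to \<open>n + 1\<close> multiplies the left binomial by
  \<open>(n + 1) / (n + 1 - k)\<close> and the right one by
  \<open>(n + 1 - k) / (n + 1 - 2 * k)\<close>; the second factor is the larger.\<close>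

lemma choose_shrink_bound_Suc:
  assumes "2 * k \<le> n" and less: "n choose k < 2 * ((n - k) choose k)"
  shows "Suc n choose k < 2 * ((Suc n - k) choose k)"
proof -
  obtain r where n: "n = 2 * k + r" using assms(1) le_Suc_ex by blast
  define c e c' e' where "c = n choose k" and "e = (n - k) choose k"
    and "c' = Suc n choose k" and "e' = (Suc n - k) choose k"
  have absorb: "(Suc m choose k) * (Suc m - k) = Suc m * (m choose k)" for m
  proof (cases "k \<le> m")
    case True
    then show ?thesis
      using binomial_absorb_comp[of "Suc m" k] by (simp add: mult.commute)
  next
    case False
    then show ?thesis by (cases "k = Suc m") (auto simp: binomial_eq_0)
  qed
  have c': "c' * (k + r + 1) = (2 * k + r + 1) * c"
    using absorb[of n] by (simp add: c'_def c_def n)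
  have e': "e' * (r + 1) = (k + r + 1) * e"
    using absorb[of "n - k"] by (simp add: e'_def e_def n Suc_diff_le)
  have "c' * ((k + r + 1) * (r + 1)) = ((2 * k + r + 1) * (r + 1)) * c"
    using c' by (metis mult.commute mult.left_commute)
  also have "\<dots> \<le> ((k + r + 1) * (k + r + 1)) * c"
    by (intro mult_right_mono) (simp_all add: algebra_simps)
  also have "\<dots> < ((k + r + 1) * (k + r + 1)) * (2 * e)"
    using less by (intro mult_strict_left_mono) (simp_all add: c_def e_def)
  also have "\<dots> = (2 * e') * ((k + r + 1) * (r + 1))"
    using e' by (metis mult.commute mult.left_commute)
  finally show ?thesis by (simp only: mult_less_cancel2 c'_def e'_def)
qed

lemma choose_diff_eq_sum:
  "b \<le> n \<Longrightarrow> (n choose Suc k) = ((n - b) choose Suc k) + (\<Sum>j<b. (n - Suc j) choose k)"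
proof (induction b)
  case (Suc b)
  then have "n - b = Suc (n - Suc b)" by simp
  then have "(n - b) choose Suc k = ((n - Suc b) choose Suc k) + ((n - Suc b) choose k)" by simp
  with Suc show ?case by simp
qed simp

text \<open>The binomial expansion cut off after its quadratic term; each induction step discards
  the nonpositive \<open>- j * (j - 1) / 2 * x ^ 3\<close>.\<close>

lemma one_minus_power_le:
  fixes x :: real
  assumes "0 \<le> x" "x \<le> 1"
  shows "(1 - x) ^ j \<le> 1 - real j * x + real j * (real j - 1) / 2 * x\<^sup>2"
proof (induction j)
  case (Suc j)
  have "(1 - x) ^ Suc j \<le> (1 - x) * (1 - real j * x + real j * (real j - 1) / 2 * x\<^sup>2)"
    using Suc assms by (simp add: mult_left_mono)
  also have "\<dots> = 1 - real (Suc j) * x + real (Suc j) * (real (Suc j) - 1) / 2 * x\<^sup>2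
      - real j * (real j - 1) / 2 * x ^ 3"
    by (simp add: field_simps power2_eq_square power3_eq_cube)
  also have "\<dots> \<le> 1 - real (Suc j) * x + real (Suc j) * (real (Suc j) - 1) / 2 * x\<^sup>2"
    using assms by (cases j) auto
  finally show ?case .
qed simp

lemma sum_quadratic_bound:
  fixes x :: real
  shows "(\<Sum>j<k. 1 - real j * x + real j * (real j - 1) / 2 * x\<^sup>2)
    = real k - real k * (real k - 1) / 2 * x + real k * (real k - 1) * (real k - 2) / 6 * x\<^sup>2"
  by (induction k) (simp_all add: field_simps power2_eq_square)

text \<open>With \<open>x = (k - 1) / (n - 1)\<close>, consecutive terms of
  \<open>(n choose k) - ((n - k) choose k) = (\<Sum>j<k. (n - 1 - j) choose (k - 1))\<close> have ratio at most \<open>1 - x\<close>.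
  The quadratic bound on \<open>(1 - x) ^ j\<close> is too weak for \<open>5 \<le> k \<le> 8\<close>, so \<open>k < 9\<close> is left to computation.\<close>

lemma choose_shrink_bound_large:
  assumes k: "9 \<le> k" and n: "2 * n = 3 * k\<^sup>2 + k + 2"
  shows "n choose k < 2 * ((n - k) choose k)"
proof -
  obtain l where l: "k = Suc l" using k by (cases k) auto
  have "k \<le> k\<^sup>2" using k by (simp add: power2_eq_square)
  then have kn: "k \<le> n" "2 \<le> n" using k n by linarith+
  define m x where "m = real n - 1" and "x = (real k - 1) / m"
  have m: "m = real k * (3 * real k + 1) / 2"
  proof -
    have "2 * real n = 3 * (real k)\<^sup>2 + real k + 2" using arg_cong[OF n, of real] by simp
    then show ?thesis by (simp add: m_def field_simps power2_eq_square)
  qed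
  have m0: "m > 0" using kn by (simp add: m_def)
  have x: "0 \<le> x" "x \<le> 1" using kn k m0 by (auto simp: x_def m_def field_simps)
  define b where "b j = real ((n - Suc j) choose l)" for j
  have b_step: "b (Suc j) \<le> (1 - x) * b j" if "Suc j < k" for j
  proof -
    have "n - Suc j = Suc (n - Suc (Suc j))" using that kn by simp
    then obtain r where r: "n - Suc j = Suc r" by blast
    have "b (Suc j) * real (Suc r) = (real (Suc r) - real l) * b j"
    proof -
      have "(real (Suc r) - real l) * real (Suc r choose l) = real (Suc r) * real (r choose l)"
      proof (cases "l \<le> Suc r")
        case True
        have "(Suc r - l) * (Suc r choose l) = Suc r * (r choose l)"
          using binomial_absorb_comp[of "Suc r" l] by simp
        then have "real (Suc r - l) * real (Suc r choose l) = real (Suc r) * real (r choose l)"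
          by (metis of_nat_mult)
        then show ?thesis using True by (simp only: of_nat_diff)
      qed (simp add: binomial_eq_0)
      moreover have "n - Suc (Suc j) = r" using r by simp
      ultimately show ?thesis by (simp add: b_def r mult.commute)
    qed
    then have "b (Suc j) = (1 - real l / real (Suc r)) * b j" by (simp add: field_simps)
    also have "\<dots> \<le> (1 - x) * b j"
    proof (rule mult_right_mono)
      have "real (Suc r) \<le> m" using r by (simp add: m_def)
      then have "real l / m \<le> real l / real (Suc r)" using m0 by (intro divide_left_mono) auto
      then show "1 - real l / real (Suc r) \<le> 1 - x" by (simp add: x_def l)
    qed (simp add: b_def)
    finally show ?thesis .
  qed
  have b_le: "b j \<le> (1 - x) ^ j * b 0" if "j < k" for j
    using that
  proof (induction j)
    case (Suc j)
    have "b (Suc j) \<le> (1 - x) * b j" using b_step Suc by simp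
    also have "\<dots> \<le> (1 - x) * ((1 - x) ^ j * b 0)" using Suc x by (intro mult_left_mono) auto
    finally show ?case by simp
  qed simp
  define T where "T = real k - real k * (real k - 1) / 2 * x + real k * (real k - 1) * (real k - 2) / 6 * x\<^sup>2"
  have "(\<Sum>j<k. b j) \<le> (\<Sum>j<k. (1 - real j * x + real j * (real j - 1) / 2 * x\<^sup>2) * b 0)"
  proof (rule sum_mono)
    fix j assume "j \<in> {..<k}"
    then have "b j \<le> (1 - x) ^ j * b 0" using b_le by simp
    also have "\<dots> \<le> (1 - real j * x + real j * (real j - 1) / 2 * x\<^sup>2) * b 0"
      using one_minus_power_le[OF x] by (intro mult_right_mono) (auto simp: b_def)
    finally show "b j \<le> (1 - real j * x + real j * (real j - 1) / 2 * x\<^sup>2) * b 0" .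
  qed
  also have "\<dots> = T * b 0" by (simp only: sum_distrib_right[symmetric] sum_quadratic_bound T_def)
  finally have sum_le: "(\<Sum>j<k. b j) \<le> T * b 0" .
  have b0: "real n * b 0 = real k * real (n choose k)"
  proof -
    have "k * (n choose k) = n * ((n - 1) choose (k - 1))" using kn by (intro times_binomial_minus1_eq) (use k in simp)
    then have "real k * real (n choose k) = real n * real ((n - 1) choose (k - 1))" by (metis of_nat_mult)
    then show ?thesis by (simp add: b_def l)
  qed
  \<comment> \<open>As \<open>n * b 0 = k * (n choose k)\<close>, this makes \<open>T * b 0\<close>
    less than half of \<open>n choose k\<close>.\<close>
  have T: "2 * real k * T < real n"
  proof -
    \<comment> \<open>Written in \<open>j = k - 9\<close>, the quartic below has only positive
      coefficients.\<close>
    obtain j where j: "k = j + 9" using k le_Suc_ex by (metis add.commute)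
    have k0: "real k > 0" using k by simp
    have "real k ^ 4 - 11 * real k ^ 3 + 9 * real k ^ 2 + 107 * real k - 10
        = real j ^ 4 + 25 * real j ^ 3 + 198 * real j ^ 2 + 512 * real j + 224"
      unfolding j by (simp add: algebra_simps power_numeral_reduce)
    also have "\<dots> > 0" by (intro add_nonneg_pos) simp_all
    finally have "0 < real k ^ 4 - 11 * real k ^ 3 + 9 * real k ^ 2 + 107 * real k - 10" .
    then have pol: "8 * (real k - 1)^3 * (real k - 2) + 12 * (real k)\<^sup>2 * (3 * real k + 1)^2
        - 12 * (real k - 1)^2 * real k * (3 * real k + 1)
        < 3 * (3 * real k + 1)^2 * (3 * (real k)^2 + real k + 2)"
      by (simp add: algebra_simps power_numeral_reduce)
    have "2 * real k * T * (12 * (3 * real k + 1)^2)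
      = 2 * (8 * (real k - 1)^3 * (real k - 2) + 12 * (real k)\<^sup>2 * (3 * real k + 1)^2
        - 12 * (real k - 1)^2 * real k * (3 * real k + 1))"
    proof -
      \<comment> \<open>\<open>m = K * c / 2\<close> turns \<open>K * x * c\<close> into a
        polynomial, so the factor \<open>12 * c^2\<close> clears all denominators of
        \<open>T\<close>.\<close>
      define K c where "K = real k" and "c = 3 * K + 1"
      have h: "K * x * c = 2 * (K - 1)"
        using k0 unfolding x_def m K_def[symmetric] c_def[symmetric]
        by (simp add: K_def c_def add_pos_pos)
      have "2 * K * T * (12 * c^2)
          = 24 * K\<^sup>2 * c\<^sup>2 - 12 * (K - 1) * (K * x * c) * (K * c) + 4 * (K - 1) * (K - 2) * (K * x * c)\<^sup>2"
        unfolding T_def K_def[symmetric] by (simp add: field_simps power2_eq_square)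
      then show ?thesis
        unfolding h K_def[symmetric] c_def[symmetric]
        by (simp add: power2_eq_square power3_eq_cube algebra_simps)
    qed
    also have "\<dots> < 2 * (3 * (3 * real k + 1)^2 * (3 * (real k)^2 + real k + 2))" using pol by simp
    also have "\<dots> = real n * (12 * (3 * real k + 1)^2)"
    proof -
      have "2 * real n = 3 * (real k)\<^sup>2 + real k + 2" using arg_cong[OF n, of real] by simp
      then have "3 * (real k)\<^sup>2 + real k + 2 = 2 * real n" ..
      then show ?thesis by (simp only:) simp
    qed
    finally show ?thesis by (rule mult_right_less_imp_less) simp
  qed
  have "real (n choose k) = real ((n - k) choose k) + (\<Sum>j<k. b j)"
    using choose_diff_eq_sum[OF kn(1), of l] by (simp add: l b_def)
  then have "real (n choose k) \<le> real ((n - k) choose k) + T * b 0" using sum_le by simp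
  moreover have "2 * (T * b 0) < real (n choose k)"
  proof -
    have "b 0 > 0" using kn l by (simp add: b_def)
    then have "2 * real k * T * b 0 < real n * b 0" using T by (rule mult_strict_right_mono[rotated])
    then have "real k * (2 * (T * b 0)) < real k * real (n choose k)" using b0 by (simp add: ac_simps)
    then show ?thesis using k by simp
  qed
  ultimately have "real (n choose k) < 2 * real ((n - k) choose k)" by linarith
  then show ?thesis by (metis (mono_tags) of_nat_less_iff of_nat_mult of_nat_numeral)
qed

text \<open>As a rewrite rule this evaluates concrete binomials without the branching of Pascal's
  rule.\<close>

lemma choose_numeral:
  "(numeral m :: nat) choose numeral k
    = numeral m * ((numeral m - 1) choose (numeral k - 1)) div numeral k"
  using times_binomial_minus1_eq[of "numeral k" "numeral m"]
  by (metis nonzero_mult_div_cancel_left zero_less_numeral zero_neq_numeral)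

lemma choose_shrink_bound:
  assumes k: "1 \<le> k" and n: "3 * k\<^sup>2 + k + 2 \<le> 2 * n"
  shows "n choose k < 2 * ((n - k) choose k)"
proof -
  \<comment> \<open>The least admissible \<open>n\<close>, from which the induction starts; the
    division is exact because \<open>k * (3 * k + 1)\<close> is even.\<close>
  define n0 where "n0 = (3 * k\<^sup>2 + k + 2) div 2"
  have "even (3 * k\<^sup>2 + k + 2)" by (simp add: power2_eq_square)
  then have n0: "2 * n0 = 3 * k\<^sup>2 + k + 2" by (simp add: n0_def)
  have kn0: "2 * k \<le> n0"
  proof -
    have "k \<le> k\<^sup>2" using k by (simp add: power2_eq_square)
    then show ?thesis using n0 by linarith
  qed
  have base: "n0 choose k < 2 * ((n0 - k) choose k)"
  proof (cases "9 \<le> k")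
    case True
    then show ?thesis using n0 choose_shrink_bound_large by blast
  next
    case False
    then consider "k = 1" | "k = 2" | "k = 3" | "k = 4" | "k = 5" | "k = 6" | "k = 7" | "k = 8" using k by linarith
    then show ?thesis by cases (simp_all add: n0_def choose_numeral)
  qed
  have "n0 \<le> n" using n n0 by simp
  then show ?thesis
  proof (induction rule: dec_induct)
    case (step i)
    then show ?case using choose_shrink_bound_Suc kn0 by simp
  qed (rule base)
qed

subsection \<open>Generalized Kneser graphs\<close>

lemma vertices_kneser: "vertices (kneser_graph n k t) = {A. A \<subseteq> {1..n} \<and> card A = k}"
  by (simp add: kneser_graph_def Let_def)

lemma adjacent_kneser:
  "adjacent (kneser_graph n k t) A B \<longleftrightarrow>
    A \<in> vertices (kneser_graph n k t) \<and> B \<in> vertices (kneser_graph n k t) \<and> A \<noteq> B \<and> card (A \<inter> B) < t"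
  (is "?l \<longleftrightarrow> ?r A B")
proof
  assume ?l
  then obtain A' B' where "{A, B} = {A', B'}" "?r A' B'"
    by (auto simp: adjacent_def kneser_graph_def Let_def)
  then show "?r A B" by (metis Int_commute doubleton_eq_iff)
next
  assume "?r A B"
  then show ?l unfolding adjacent_def by (simp add: kneser_graph_def Let_def) blast
qed

lemma simple_sgraph_kneser: "simple_sgraph (kneser_graph n k t)"
proof
  show "finite (vertices (kneser_graph n k t))"
    unfolding vertices_kneser by (rule finite_subsets_card) simp
  show "\<exists>u \<in> vertices (kneser_graph n k t). \<exists>v \<in> vertices (kneser_graph n k t). u \<noteq> v \<and> e = {u, v}"
    if "e \<in> edges (kneser_graph n k t)" for e
    using that by (auto simp: kneser_graph_def Let_def)
qed

text \<open>Only disjoint sets are counted; \<open>k \<ge> 1\<close> makes them distinct from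
  \<open>A\<close>.\<close>

lemma card_neighbours_kneser_ge:
  assumes "1 \<le> t" "t \<le> k" and A: "A \<in> vertices (kneser_graph n k t)"
  shows "(n - k) choose k \<le> card (neighbours (kneser_graph n k t) A)"
proof -
  interpret simple_sgraph "kneser_graph n k t" by (rule simple_sgraph_kneser)
  have A': "A \<subseteq> {1..n}" "card A = k" using A by (auto simp: vertices_kneser)
  let ?D = "{B. B \<subseteq> {1..n} \<and> card B = k \<and> B \<inter> A = {}}"
  have card: "card ?D = (n - k) choose k"
    using card_subsets_between[of "{}" n A k] A' by simp
  have "?D \<subseteq> neighbours (kneser_graph n k t) A"
  proof
    fix B assume "B \<in> ?D"
    then have B: "B \<in> vertices (kneser_graph n k t)" "B \<inter> A = {}" "card B = k"
      by (simp_all add: vertices_kneser)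
    then have "A \<noteq> B" using assms by auto
    then show "B \<in> neighbours (kneser_graph n k t) A"
      using A B assms by (simp add: mem_neighbours adjacent_kneser Int_commute)
  qed
  with finite_neighbours have "card ?D \<le> card (neighbours (kneser_graph n k t) A)" by (rule card_mono)
  then show ?thesis by (simp only: card)
qed

theorem theorem1p2:
  fixes n k t :: nat
  assumes "k \<ge> t" and "t \<ge> 1"
    and "real n \<ge> (3 * real k ^ 2 + real k + 2) / 2"
  shows "int (scramble_number (kneser_graph n k t)) = gonality (kneser_graph n k t)
    \<and> gonality (kneser_graph n k t) = int (n choose k) - int ((n - t) choose (k - t))"
proof -
  have "real (3 * k\<^sup>2 + k + 2) \<le> real (2 * n)" using assms(3) by simp
  then have n: "3 * k\<^sup>2 + k + 2 \<le> 2 * n" by (simp only: of_nat_le_iff)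
  have "k \<le> k\<^sup>2" by (simp add: power2_eq_square)
  then have kn: "k < n" using n by linarith
  let ?G = "kneser_graph n k t"
  let ?I = "{A. A \<subseteq> {1..n} \<and> card A = k \<and> {1..t} \<subseteq> A}"
  have cardV: "card (vertices ?G) = n choose k"
    using n_subsets[of "{1..n}" k] by (simp add: vertices_kneser)
  have "0 < n choose k" using kn by simp
  then have ne: "vertices ?G \<noteq> {}" using cardV by auto
  interpret dense_sgraph ?G "(n - k) choose k"
  proof (intro dense_sgraph.intro simple_sgraph_kneser dense_sgraph_axioms.intro)
    show "card (vertices ?G) < 2 * ((n - k) choose k)"
      unfolding cardV using choose_shrink_bound n assms by simp
  qed (use ne card_neighbours_kneser_ge assms in auto)
  have cardI: "card ?I = (n - t) choose (k - t)"
    using card_supersets[of "{1..t}" n k] assms kn by simp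
  have "0 < (n - t) choose (k - t)" using kn by simp
  then have I_ne: "?I \<noteq> {}" using cardI by (metis card.empty less_irrefl)
  have indep: "independent ?I"
  proof -
    have "t \<le> card (A \<inter> B)" if "A \<in> ?I" "B \<in> ?I" for A B
    proof -
      have "finite (A \<inter> B)" using that finite_subset[of A "{1..n}"] by simp
      then show ?thesis using that card_mono[of "A \<inter> B" "{1..t}"] by simp
    qed
    then have "\<not> adjacent ?G A B" if "A \<in> ?I" "B \<in> ?I" for A B
      using that by (simp only: adjacent_kneser not_less[symmetric]) blast
    moreover have "?I \<subseteq> V" unfolding vertices_kneser by blast
    ultimately show ?thesis unfolding independent_def by blast
  qed
  have max: "card J \<le> card ?I" if J: "independent J" for J
  proof -
    have uni: "uniform_family n k J"
      using J by (simp add: uniform_family_def independent_def vertices_kneser)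
    have "t \<le> card (A \<inter> B)" if AB: "A \<in> J" "B \<in> J" for A B
    \<comment> \<open>Independence says nothing about \<open>A = B\<close>, where
      \<open>card A = k \<ge> t\<close> steps in.\<close>
    proof (cases "A = B")
      case True
      then show ?thesis using uniform_familyD(3)[OF uni AB(1)] assms by simp
    next
      case False
      then show ?thesis
        using J AB by (fastforce simp: independent_def adjacent_kneser)
    qed
    then have "intersecting_family t J" by (simp add: intersecting_family_def)
    then show ?thesis unfolding cardI using erdos_ko_rado_quadratic uni n assms by blast
  qed
  \<comment> \<open>If the star were the whole vertex set, the graph would have no edges, but all
    degrees are positive.\<close>
  have I_neq: "?I \<noteq> vertices ?G"
  proof
    assume "?I = vertices ?G"
    moreover obtain v where "v \<in> vertices ?G" using nonempty by blast
    moreover from this have "neighbours ?G v \<noteq> {}"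
      using degree_ge[of v] dense by (metis card.empty le_zero_eq mult_0_right not_less0)
    ultimately show False
      using indep neighbours_subset[of v] by (auto simp: independent_def mem_neighbours)
  qed
  have "scramble_number ?G = card V - card ?I"
    by (rule scramble_number_eq[OF indep _ I_ne I_neq]) (rule max)
  then have "scramble_number ?G = (n choose k) - ((n - t) choose (k - t))"
    by (simp only: cardV cardI)
  moreover have "(n - t) choose (k - t) \<le> n choose k"
    using indep finite_vertices card_mono[of V ?I] by (simp only: cardV cardI independent_def)
  moreover have "gonality ?G = int (card V) - int (card ?I)"
    by (rule gonality_eq[OF indep _ I_ne]) (rule max)
  then have "gonality ?G = int (n choose k) - int ((n - t) choose (k - t))"
    by (simp only: cardV cardI)
  ultimately show ?thesis by (simp add: of_nat_diff)
qed

end
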